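(* Let $(I_t)_{t\in\mathbb{Z}}$ be a stochastic process such that there exists a family $(I_t^n)_{t\in\mathbb{Z}}$, $n\in\mathbb{N}$, of $\{0,1\}$-valued stationary stochastic processes with $P(I_0^n=1)>0$ for all $n$ and $$\mathcal{L}\bigl((I_t^n)_{t\in\{-u,\dots,v\}}\mid I_0^n=1\bigr)\Longrightarrow \mathcal{L}\bigl((I_t)_{t\in\{-u,\dots,v\}}\bigr)\quad (n\to\infty)$$ for all $u,v\in\mathbb{N}$. Define $S^i=\sum_{t\in\mathbb{Z}}I_t\in\mathbb{N}\cup\{\infty\}$, $S_+^i=\sum_{t=1}^\infty I_t$, $S_-^i=\sum_{t=1}^\infty I_{-t}$, let $S^i_{\pm}$ denote a random variable with the common distribution of $S_+^i$ and $S_-^i$, and let $\theta:=P(S^i_{\pm}=0)=P(I_t=0\ \forall t>0)$. When $\theta>0$, let $S^t$ be a random variable with law $\mathcal{L}(S^i\mid S_-^i=0)$. (a) The three statements $\theta=0$, $P(S^i_{\pm}=\infty)=1$ and $P(S^i=\infty)=1$ are equivalent. (b) $\theta>0$ if and only if $P(S^i<\infty)>0$. If $\theta>0$, then $$\theta=\frac{P(S^i_{\pm}<\infty)}{E(S^t)}.$$ If in addition $P(S^i_{\pm}<\infty)=1$, then $$\theta^{-1}=E(S^t)\le E(S^i)=1+2E(S^i_{\pm})\quad\text{and}\quad E(S^i)=\frac{E((S^t)^2)}{E(S^t)},$$ where the right-hand side of the inequality and both sides of the last equation may equal $\infty$. Equality holds in $E(S^t)\le E(S^i)$ only if there exists $k\in\mathbb{N}$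 with $P(S^i=k)=1$.
   Context: $\mathbb{N}=\{1,2,\dots\}$. $S^i$ is the inspected cluster size, $S^t$ the typical cluster size, $\theta$ the extremal index. $\mathcal{L}(\cdot\mid\cdot)$ denotes conditional law and $\Longrightarrow$ convergence in distribution. *)

theory Defs
  imports "HOL-Probability.Probability"
begin

definition window :: "(int \<Rightarrow> 'a \<Rightarrow> real) \<Rightarrow> nat \<Rightarrow> nat \<Rightarrow> 'a \<Rightarrow> (int \<Rightarrow> real)" where
  "window X u v \<omega> = (\<lambda>t. if - int u \<le> t \<and> t \<le> int v then X t \<omega> else 0)"

definition stationary_process :: "'a measure \<Rightarrow> (int \<Rightarrow> 'a \<Rightarrow> real) \<Rightarrow> bool" where
  "stationary_process M X \<longleftrightarrow>
     (\<forall>h u v. distr M borel (window (\<lambda>t. X (t + h)) u v) = distr M borel (window X u v))"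

definition conv_in_distr :: "(nat \<Rightarrow> (int \<Rightarrow> real) measure) \<Rightarrow> (int \<Rightarrow> real) measure \<Rightarrow> bool" where
  "conv_in_distr Ms M \<longleftrightarrow>
     (\<forall>f :: (int \<Rightarrow> real) \<Rightarrow> real. continuous_on UNIV f \<longrightarrow> bounded (range f) \<longrightarrow>
        (\<lambda>n. \<integral>x. f x \<partial>Ms n) \<longlonglongrightarrow> (\<integral>x. f x \<partial>M))"

abbreviation cond_measure :: "'a measure \<Rightarrow> 'a set \<Rightarrow> 'a measure" where
  "cond_measure M A \<equiv> uniform_measure M A"

definition S_i :: "(int \<Rightarrow> 'a \<Rightarrow> real) \<Rightarrow> 'a \<Rightarrow> ennreal" where
  "S_i I \<omega> = (\<Sum>\<^sub>\<infinity> t\<in>(UNIV :: int set). ennreal (I t \<omega>))"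

definition S_plus :: "(int \<Rightarrow> 'a \<Rightarrow> real) \<Rightarrow> 'a \<Rightarrow> ennreal" where
  "S_plus I \<omega> = (\<Sum>\<^sub>\<infinity> t\<in>{1::int..}. ennreal (I t \<omega>))"

definition S_minus :: "(int \<Rightarrow> 'a \<Rightarrow> real) \<Rightarrow> 'a \<Rightarrow> ennreal" where
  "S_minus I \<omega> = (\<Sum>\<^sub>\<infinity> t\<in>{1::int..}. ennreal (I (- t) \<omega>))"

end

theory Submission
  imports Defs
begin

text \<open>
  Conditioning stationary $0/1$-processes on a one at the origin makes the limit a Palm version:
  for all $s$, the configuration on the event of a point at $s$ has the same law as the
  configuration shifted by $s$ on the event of a point at $-s$. Summing over $s$ gives a mass
  transport principle: the expected mass sent by the origin to the points of the configuration
  equals the expected mass that it receives.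

  If each point sends mass $\psi(S)$ to the first point of the cluster, where $S$ is the cluster
  size, then $E[\psi(S); S_- < \infty] = E[S \psi(S); S_- = 0]$. The choices
  $\psi = 1, s, 1/s, 1_{\{s = \infty\}}$ give all moment identities, and the inequality is that
  between harmonic and arithmetic mean of $S$. If each point sends unit mass to its $k$-th successor,
  then $P(S_+ \ge k) = P(S_- \ge k)$.
\<close>

subsection \<open>Point configurations on the integers\<close>

text \<open>The probabilities of a one at the origin may tend to zero along the sequence, so the
  limit need not be a stationary process conditioned on an event, and stationarity itself is lost.
  What survives is the shift identity for finitely many sites. Only bounded continuous functionals
  are known to converge, and \<open>I\<close> is not given as 0/1-valued; it is therefore shown to
  be so almost surely and replaced by a boolean configuration, whose law carries the transport
  argument. Finiteness is itself a result of transport: for \<psi> the indicator of \<infinity>, the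
  sent mass is at most 1 while the received mass is 0 or \<infinity>.\<close>

abbreviation path_space :: "(int \<Rightarrow> bool) measure" where
  "path_space \<equiv> Pi\<^sub>M UNIV (\<lambda>_. count_space UNIV)"

text \<open>Counting measure rather than \<open>card\<close>, so that an infinite set of points
  counts as \<infinity> and not as 0.\<close>

definition npoints :: "int set \<Rightarrow> (int \<Rightarrow> bool) \<Rightarrow> ennreal" where
  "npoints A x = emeasure (count_space UNIV) {t\<in>A. x t}"

lemma space_path_space: "space path_space = UNIV"
  by (simp add: space_PiM)

lemma npoints_eq_nn_integral:
  "npoints A x = (\<integral>\<^sup>+t. indicator {t\<in>A. x t} t \<partial>count_space UNIV)"
  by (simp add: npoints_def)

lemma npoints_finite: "finite {t\<in>A. x t} \<Longrightarrow> npoints A x = of_nat (card {t\<in>A. x t})"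
  by (simp add: npoints_def)

lemma npoints_infinite: "infinite {t\<in>A. x t} \<Longrightarrow> npoints A x = \<infinity>"
  by (simp add: npoints_def)

lemma npoints_less_top_iff: "npoints A x < \<top> \<longleftrightarrow> finite {t\<in>A. x t}"
  by (cases "finite {t\<in>A. x t}")
     (simp_all add: npoints_finite npoints_infinite of_nat_less_top)

lemma npoints_eq_0_iff: "npoints A x = 0 \<longleftrightarrow> (\<forall>t\<in>A. \<not> x t)"
  by (auto simp: npoints_def emeasure_count_space_eq_0)

lemma measurable_coord [measurable]: "(\<lambda>x. x t) \<in> measurable path_space (count_space UNIV)"
  by measurable

text \<open>With a countable index, measurability of every slice gives joint measurability, and
  integrating out one variable against the sigma-finite counting measure preserves it.\<close>

lemma borel_measurable_nn_integral_count_space: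
  fixes f :: "'a \<Rightarrow> 'i::countable \<Rightarrow> ennreal"
  assumes [measurable]: "\<And>t. (\<lambda>x. f x t) \<in> borel_measurable M"
  shows "(\<lambda>x. \<integral>\<^sup>+t. f x t \<partial>count_space UNIV) \<in> borel_measurable M"
proof -
  interpret sigma_finite_measure "count_space (UNIV :: 'i set)"
    by (rule sigma_finite_measure_count_space)
  have "(\<lambda>(x, t). f x t) \<in> borel_measurable (M \<Otimes>\<^sub>M count_space UNIV)"
    unfolding split_beta
    by (rule measurable_compose_countable'[where f="\<lambda>t p. f (fst p) t" and g=snd and I=UNIV]) auto
  then show ?thesis
    by (rule borel_measurable_nn_integral)
qed

lemma measurable_npoints [measurable]: "npoints A \<in> borel_measurable path_space"
proof -
  have "(\<lambda>x. \<integral>\<^sup>+t. of_bool (t \<in> A \<and> x t) \<partial>count_space UNIV) \<in> borel_measurable path_space"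
    by (rule borel_measurable_nn_integral_count_space) measurable
  also have "(\<lambda>x. \<integral>\<^sup>+t. of_bool (t \<in> A \<and> x t) \<partial>count_space UNIV) = npoints A"
    by (auto simp: npoints_eq_nn_integral fun_eq_iff indicator_def intro!: nn_integral_cong)
  finally show ?thesis .
qed

lemma shift_measurable [measurable]:
  "(\<lambda>x t. x (t + s)) \<in> measurable path_space path_space"
  by (rule measurable_PiM_single') (auto simp: space_PiM)

text \<open>Connects the unordered sums that define the cluster sizes with point counts; in the
  infinite case infinitely many terms equal 1.\<close>

lemma infsum_ennreal_of_bool: "(\<Sum>\<^sub>\<infinity>t\<in>A. ennreal (of_bool (x t))) = npoints A x"
proof (cases "finite {t\<in>A. x t}")
  case True
  have "(\<Sum>\<^sub>\<infinity>t\<in>A. ennreal (of_bool (x t))) = (\<Sum>\<^sub>\<infinity>t\<in>{t\<in>A. x t}. ennreal (of_bool (x t)))"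
    by (rule infsum_cong_neutral) auto
  also have "\<dots> = npoints A x"
    using True by (simp add: npoints_finite)
  finally show ?thesis .
next
  case False
  have "(\<Sum>\<^sub>\<infinity>t\<in>A. ennreal (of_bool (x t))) = (\<Sum>\<^sub>\<infinity>t\<in>{t\<in>A. x t}. ennreal (of_bool (x t)))"
    by (rule infsum_cong_neutral) auto
  also have "\<dots> = \<infinity>"
    using False by (intro infsum_superconst_infinite_ennreal[where b=1]) auto
  finally show ?thesis
    using False by (simp add: npoints_infinite)
qed

lemma npoints_image:
  assumes "inj f"
  shows "npoints A (\<lambda>t. x (f t)) = npoints (f ` A) x"
proof -
  have *: "{t \<in> f ` A. x t} = f ` {t \<in> A. x (f t)}"
    by auto
  have inj: "inj_on f {t \<in> A. x (f t)}"
    using assms by (rule inj_on_subset) auto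
  show ?thesis
    by (cases "finite {t \<in> A. x (f t)}")
       (simp_all add: npoints_def * card_image[OF inj] finite_image_iff[OF inj])
qed

text \<open>Evaluates a selection rule: if at most one site qualifies, the mass sent out is 1 or 0.
  It serves for the first point and for the k-th successor.\<close>

lemma nn_integral_count_space_unique:
  assumes "\<And>s s'. P s \<Longrightarrow> P s' \<Longrightarrow> s = s'"
  shows "(\<integral>\<^sup>+s. of_bool (P s) \<partial>count_space UNIV) = of_bool (\<exists>s. P s)"
proof (cases "\<exists>s. P s")
  case True
  then obtain s where "P s" by blast
  then have "P = (\<lambda>s'. s' = s)"
    using assms by blast
  then have "(\<integral>\<^sup>+s. of_bool (P s) \<partial>count_space UNIV) = (\<integral>\<^sup>+s'. indicator {s} s' \<partial>count_space UNIV)"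
    by (intro nn_integral_cong) (simp add: indicator_def)
  also have "\<dots> = 1"
    by (subst nn_integral_indicator) auto
  finally show ?thesis
    using True by simp
qed simp

text \<open>A first point bounds the configuration from below; conversely the origin and finitely
  many points to its left have a minimum.\<close>

lemma nn_integral_first_point:
  assumes "x 0"
  shows "(\<integral>\<^sup>+s. of_bool (x s \<and> (\<forall>t<s. \<not> x t)) \<partial>count_space UNIV) = of_bool (npoints {..<0::int} x < \<infinity>)"
proof -
  have "(\<exists>s. x s \<and> (\<forall>t<s. \<not> x t)) \<longleftrightarrow> finite {t \<in> {..<0}. x t}" (is "?L \<longleftrightarrow> ?R")
  proof
    assume ?L
    then obtain s where "x s" "\<forall>t<s. \<not> x t" by blast
    then have "{t \<in> {..<0}. x t} \<subseteq> {s..<0}"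
      by force
    then show ?R
      using finite_subset by blast
  next
    assume fin: ?R
    \<comment> \<open>The origin is inserted to make the set nonempty; it is itself the first point
      if nothing lies to its left.\<close>
    define m where "m = Min (insert 0 {t \<in> {..<0}. x t})"
    have "m \<in> insert 0 {t \<in> {..<0}. x t}"
      unfolding m_def by (rule Min_in) (use fin in auto)
    moreover have "m \<le> t" if "x t" for t
      using that fin unfolding m_def by (cases "t < 0") (auto simp: Min_le_iff intro: Min_le)
    ultimately show ?L
      using assms by (intro exI[of _ m]) (auto simp: not_le[symmetric])
  qed
  moreover have "s = s'" if "x s \<and> (\<forall>t<s. \<not> x t)" "x s' \<and> (\<forall>t<s'. \<not> x t)" for s s'
    by (cases s s' rule: linorder_cases) (use that in simp_all)
  from nn_integral_count_space_unique[of "\<lambda>s. x s \<and> (\<forall>t<s. \<not> x t)", OF this]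
  have "(\<integral>\<^sup>+s. of_bool (x s \<and> (\<forall>t<s. \<not> x t)) \<partial>count_space UNIV) = of_bool (\<exists>s. x s \<and> (\<forall>t<s. \<not> x t))" .
  ultimately show ?thesis
    by (simp add: npoints_less_top_iff)
qed

text \<open>The count \<open>c s\<close> of points in \<open>{0<..s}\<close> increases strictly at
  points, whence uniqueness, and by at most one from site to site, so it cannot skip the value k.
  For k = 0 the left side would be 0 and the right side 1.\<close>

lemma nn_integral_kth_point:
  assumes "k > 0"
  shows "(\<integral>\<^sup>+s. of_bool (0 < s \<and> x s \<and> npoints {0<..s::int} x = of_nat k) \<partial>count_space UNIV) =
    of_bool (of_nat k \<le> npoints {0<..} x)"
proof -
  define c where "c s = card {t \<in> {0<..s}. x t}" for s :: int
  have fin: "finite {t \<in> {0<..s}. x t}" for s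
    by (rule finite_subset[of _ "{0<..s}"]) auto
  then have np: "npoints {0<..s} x = of_nat (c s)" for s
    unfolding c_def by (rule npoints_finite)
  have less: "c s < c s'" if "s < s'" "0 < s'" "x s'" for s s'
    unfolding c_def
  proof (rule psubset_card_mono[OF fin], rule psubsetI)
    show "{t \<in> {0<..s}. x t} \<subseteq> {t \<in> {0<..s'}. x t}"
      using that(1) by auto
    have "s' \<in> {t \<in> {0<..s'}. x t}" "s' \<notin> {t \<in> {0<..s}. x t}"
      using that by simp_all
    then show "{t \<in> {0<..s}. x t} \<noteq> {t \<in> {0<..s'}. x t}"
      by blast
  qed
  have uniq: "s = s'" if "0 < s \<and> x s \<and> c s = k" "0 < s' \<and> x s' \<and> c s' = k" for s s'
    using less that by (metis linorder_neqE less_irrefl)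
  have ex_iff: "(\<exists>s. 0 < s \<and> x s \<and> c s = k) \<longleftrightarrow> of_nat k \<le> npoints {0<..} x" (is "?L \<longleftrightarrow> ?R")
  proof
    assume ?L
    then obtain s where "c s = k" by blast
    then have "of_nat k = npoints {0<..s} x"
      by (simp add: np)
    also have "\<dots> \<le> npoints {0<..} x"
      unfolding npoints_def by (rule emeasure_mono) auto
    finally show ?R .
  next
    assume ?R
    \<comment> \<open>Exactly k points are chosen, whether the right half holds finitely or
      infinitely many; at their maximum the count is at least k.\<close>
    obtain F where F: "F \<subseteq> {t \<in> {0<..}. x t}" "card F = k" "finite F"
    proof (cases "finite {t \<in> {0<..}. x t}")
      case True
      then have "(of_nat k :: ennreal) \<le> of_nat (card {t \<in> {0<..}. x t})"
        using \<open>?R\<close> npoints_finite[OF True] by argo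
      then have "k \<le> card {t \<in> {0<..}. x t}"
        by (rule of_nat_le_iff[THEN iffD1])
      then show ?thesis
        using that by (rule obtain_subset_with_card_n)
    next
      case False
      then show ?thesis
        using that infinite_arbitrarily_large[OF False, of k] by blast
    qed
    have "F \<subseteq> {t \<in> {0<..Max F}. x t}"
      using F by auto
    then have "card F \<le> c (Max F)"
      unfolding c_def by (rule card_mono[OF fin])
    then have "k \<le> c (Max F)"
      by (simp add: F(2))
    moreover have "F \<noteq> {}"
      using F \<open>k > 0\<close> by auto
    then have "0 < Max F"
      using F Max_in[OF F(3)] by blast
    ultimately have ex: "k \<le> c (int (nat (Max F)))"
      by simp
    \<comment> \<open>Among the naturals a least site exists. It is not 0, where the count is 0; one
      site earlier the count is below k, so a jump by one to exactly k occurs at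
      \<open>int n\<close>.\<close>
    define n where "n = (LEAST n. k \<le> c (int n))"
    have n: "k \<le> c (int n)"
      unfolding n_def using ex by (rule LeastI)
    have "n \<noteq> 0"
    proof
      assume "n = 0"
      then show False using n \<open>k > 0\<close> by (simp add: c_def)
    qed
    then obtain m where m: "n = Suc m"
      using not0_implies_Suc by blast
    then have "m < n"
      by simp
    then have "\<not> k \<le> c (int m)"
      unfolding n_def by (rule not_less_Least)
    moreover have "c (int n) = (if x (int n) then Suc (c (int m)) else c (int m))"
    proof -
      have "{t \<in> {0<..int n}. x t} =
        (if x (int n) then insert (int n) {t \<in> {0<..int m}. x t} else {t \<in> {0<..int m}. x t})"
        (is "?A = ?B")
      proof (rule set_eqI)
        fix t show "t \<in> ?A \<longleftrightarrow> t \<in> ?B"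
          using m by (cases "t = int n") auto
      qed
      then have "c (int n) = card ?B"
        unfolding c_def by (rule arg_cong)
      also have "int n \<notin> {t \<in> {0<..int m}. x t}"
        using m by simp
      then have "card ?B = (if x (int n) then Suc (c (int m)) else c (int m))"
        unfolding c_def by (cases "x (int n)") (simp_all only: if_True if_False card_insert_disjoint[OF fin] not_False_eq_True)
      finally show ?thesis .
    qed
    ultimately have "x (int n)" "c (int n) = k"
      using n by (auto split: if_splits)
    then show ?L
      using m by (intro exI[of _ "int n"]) auto
  qed
  have "(\<integral>\<^sup>+s. of_bool (0 < s \<and> x s \<and> c s = k) \<partial>count_space UNIV) =
    of_bool (\<exists>s. 0 < s \<and> x s \<and> c s = k)"
    by (rule nn_integral_count_space_unique) (rule uniq)
  then show ?thesis
    by (simp only: np of_nat_eq_iff ex_iff)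
qed

abbreviation "ntotal \<equiv> npoints UNIV :: (int \<Rightarrow> bool) \<Rightarrow> ennreal"
abbreviation "nright \<equiv> npoints {0<..} :: (int \<Rightarrow> bool) \<Rightarrow> ennreal"
abbreviation "nleft \<equiv> npoints {..<0} :: (int \<Rightarrow> bool) \<Rightarrow> ennreal"

text \<open>With a = 1 / E(1/f), the nonnegative function (f - a)^2 / f has expectation E(f) - a. If
  this vanishes, f = a almost surely.\<close>

lemma (in prob_space) harmonic_mean_le_expectation:
  fixes f :: "'a \<Rightarrow> real"
  assumes int: "integrable M f" "integrable M (\<lambda>x. 1 / f x)" and pos: "AE x in M. f x > 0"
  shows "1 / expectation (\<lambda>x. 1 / f x) \<le> expectation f"
    and "1 / expectation (\<lambda>x. 1 / f x) = expectation f \<Longrightarrow> AE x in M. f x = expectation f"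
proof -
  define \<theta> where "\<theta> = expectation (\<lambda>x. 1 / f x)"
  define a where "a = 1 / \<theta>"
  have nonneg: "AE x in M. 0 \<le> 1 / f x"
    using pos by eventually_elim simp
  have "\<theta> \<ge> 0"
    unfolding \<theta>_def by (rule integral_nonneg_AE) (rule nonneg)
  moreover have "\<theta> \<noteq> 0"
  proof
    assume "\<theta> = 0"
    then have "AE x in M. 1 / f x = 0"
      using integral_nonneg_eq_0_iff_AE[OF int(2) nonneg] unfolding \<theta>_def by simp
    with pos have "AE x in M. False"
      by eventually_elim simp
    then show False by simp
  qed
  ultimately have a: "a\<^sup>2 * \<theta> = a"
    by (simp add: a_def power2_eq_square)
  \<comment> \<open>The expanded form of (f - a)^2 / f, whose terms are integrable
    separately.\<close>
  define g where "g x = f x - 2 * a + a\<^sup>2 * (1 / f x)" for x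
  have g_eq: "AE x in M. g x = (f x - a)\<^sup>2 / f x"
    using pos by eventually_elim (simp add: g_def field_simps power2_eq_square)
  have g_nonneg: "AE x in M. 0 \<le> g x"
    using pos g_eq by eventually_elim simp
  have g_int: "integrable M g"
    unfolding g_def using int by (intro Bochner_Integration.integrable_add Bochner_Integration.integrable_diff integrable_mult_right) auto
  have "integral\<^sup>L M g = expectation f - 2 * a + a\<^sup>2 * \<theta>"
    unfolding g_def \<theta>_def using int by (simp add: prob_space del: times_divide_eq_right)
  then have eg: "integral\<^sup>L M g = expectation f - a"
    by (simp add: a)
  with integral_nonneg_AE[OF g_nonneg] show "1 / expectation (\<lambda>x. 1 / f x) \<le> expectation f"
    by (simp add: a_def \<theta>_def)
  assume "1 / expectation (\<lambda>x. 1 / f x) = expectation f"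
  then have a_eq: "a = expectation f"
    by (simp add: a_def \<theta>_def)
  then have "AE x in M. g x = 0"
    using eg integral_nonneg_eq_0_iff_AE[OF g_int g_nonneg] by simp
  with g_eq pos show "AE x in M. f x = expectation f"
    unfolding a_eq by eventually_elim simp
qed

subsection \<open>Mass transport\<close>

text \<open>The shift identity is required on cylinders only, which is what finite windows can
  supply in the limit; \<open>palm_shift\<close> extends it to all measurable functionals.\<close>

locale palm_process = prob_space N for N :: "(int \<Rightarrow> bool) measure" +
  assumes sets_N [measurable_cong]: "sets N = sets path_space"
    and AE_origin: "AE x in N. x 0"
    and cylinder_shift: "\<And>J A s. finite J \<Longrightarrow>
      emeasure N {x. x s \<and> (\<forall>j\<in>J. x j \<in> A j)} =
      emeasure N {x. x (- s) \<and> (\<forall>j\<in>J. x (j - s) \<in> A j)}"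
begin

lemma space_N [simp]: "space N = UNIV"
  using sets_eq_imp_space_eq[OF sets_N] by (simp add: space_path_space)

lemma pred_N_sets: "Measurable.pred path_space P \<Longrightarrow> {x. P x} \<in> sets N"
  by (simp add: pred_def sets_N space_path_space)

lemma emeasure_eq_nn_integral:
  assumes "Measurable.pred path_space P"
  shows "emeasure N {x. P x} = (\<integral>\<^sup>+x. of_bool (P x) \<partial>N)"
proof -
  have "(\<integral>\<^sup>+x. of_bool (P x) \<partial>N) = (\<integral>\<^sup>+x. indicator {x. P x} x \<partial>N)"
    by (intro nn_integral_cong) (simp add: indicator_def)
  also have "\<dots> = emeasure N {x. P x}"
    by (rule nn_integral_indicator) (rule pred_N_sets[OF assms])
  finally show ?thesis by simp
qed

text \<open>Both sides integrate \<open>F\<close> against finite measures: the law restricted to a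
  point at s, and the shifted image of the law restricted to a point at - s. They agree on
  cylinders, which determine a finite measure on the product space.\<close>

lemma palm_shift:
  assumes [measurable]: "F \<in> borel_measurable path_space"
  shows "(\<integral>\<^sup>+x. F x * of_bool (x s) \<partial>N) = (\<integral>\<^sup>+x. F (\<lambda>t. x (t - s)) * of_bool (x (- s)) \<partial>N)"
proof -
  let ?S = "\<lambda>(x :: int \<Rightarrow> bool) t. x (t + (- s))"
  define P where "P = density N (indicator {x. x s})"
  define Q where "Q = distr (density N (indicator {x. x (- s)})) path_space ?S"
  have pt [measurable]: "{x. x t} \<in> sets N" for t
    by (rule pred_N_sets) measurable
  have S: "?S \<in> measurable (density N (indicator {x. x (- s)})) path_space"
    by measurable
  have [measurable]: "(\<lambda>x. F (\<lambda>t. x (t - s))) \<in> borel_measurable path_space"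
    using measurable_compose[OF shift_measurable[of "- s"] assms] by simp
  have "P = Q"
  proof (rule measure_eqI_PiM_infinite)
    show "sets P = sets path_space"
      by (simp add: P_def sets_N)
    show "sets Q = sets path_space"
      by (simp add: Q_def)
    show "finite_measure P"
    proof (rule finite_measureI)
      have "emeasure P UNIV = emeasure N {x. x s}"
        unfolding P_def using emeasure_restricted[OF pt sets.top] by simp
      then show "emeasure P (space P) \<noteq> \<infinity>"
        by (simp add: P_def emeasure_eq_measure)
    qed
    fix A :: "int \<Rightarrow> bool set" and J :: "int set"
    assume "finite J"
    have pr: "Measurable.pred path_space (\<lambda>x. x i \<in> B)" for i B
      by (rule measurable_compose[OF measurable_coord]) simp
    have emb: "prod_emb UNIV (\<lambda>_. count_space UNIV) J (Pi\<^sub>E J A) = {x. \<forall>j\<in>J. x j \<in> A j}"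
      by (rule set_eqI) (simp add: prod_emb_iff PiE_iff)
    have cyl: "{x. \<forall>j\<in>J. x j \<in> A j} \<in> sets N"
      by (intro pred_N_sets pred_intros_finite(3) pr \<open>finite J\<close>)
    have cyl': "{x. \<forall>j\<in>J. x (j - s) \<in> A j} \<in> sets N"
      by (intro pred_N_sets pred_intros_finite(3) pr \<open>finite J\<close>)
    have "emeasure P {x. \<forall>j\<in>J. x j \<in> A j} = emeasure N {x. x s \<and> (\<forall>j\<in>J. x j \<in> A j)}"
      unfolding P_def emeasure_restricted[OF pt cyl] Collect_conj_eq ..
    also have "\<dots> = emeasure N {x. x (- s) \<and> (\<forall>j\<in>J. x (j - s) \<in> A j)}"
      by (rule cylinder_shift) fact
    also have "\<dots> = emeasure (density N (indicator {x. x (- s)})) {x. \<forall>j\<in>J. x (j - s) \<in> A j}"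
      unfolding emeasure_restricted[OF pt cyl'] Collect_conj_eq ..
    also have "\<dots> = emeasure Q {x. \<forall>j\<in>J. x j \<in> A j}"
      unfolding Q_def using cyl by (subst emeasure_distr[OF S]) (simp_all add: sets_N vimage_def)
    finally show "emeasure P (prod_emb UNIV (\<lambda>_. count_space UNIV) J (Pi\<^sub>E J A)) =
      emeasure Q (prod_emb UNIV (\<lambda>_. count_space UNIV) J (Pi\<^sub>E J A))"
      by (simp add: emb)
  qed
  have "(\<integral>\<^sup>+x. F x * of_bool (x s) \<partial>N) = (\<integral>\<^sup>+x. F x \<partial>P)"
    unfolding P_def by (subst nn_integral_density) (auto intro!: nn_integral_cong simp: indicator_def)
  also have "\<dots> = (\<integral>\<^sup>+x. F (?S x) \<partial>density N (indicator {x. x (- s)}))"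
    unfolding \<open>P = Q\<close> Q_def by (rule nn_integral_distr[OF S]) measurable
  also have "\<dots> = (\<integral>\<^sup>+x. F (\<lambda>t. x (t - s)) * of_bool (x (- s)) \<partial>N)"
    by (subst nn_integral_density) (auto intro!: nn_integral_cong simp: indicator_def)
  finally show ?thesis .
qed

text \<open>\<open>G x s\<close> is the mass that the origin sends to s. Seen from s the old origin
  sits at \<open>- s\<close>, so the right side collects the mass received by the origin. This is
  \<open>palm_shift\<close> summed over s, with s replaced by - s at the end; nonnegativity lets sum
  and integral be exchanged.\<close>

lemma mass_transport:
  assumes [measurable]: "\<And>s. (\<lambda>x. G x s) \<in> borel_measurable path_space"
  shows "(\<integral>\<^sup>+x. (\<integral>\<^sup>+s. G x s * of_bool (x s) \<partial>count_space UNIV) \<partial>N) =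
    (\<integral>\<^sup>+x. (\<integral>\<^sup>+s. G (\<lambda>t. x (t + s)) (- s) * of_bool (x s) \<partial>count_space UNIV) \<partial>N)"
proof -
  have [measurable]: "(\<lambda>x. G (\<lambda>t. x (t + s)) s') \<in> borel_measurable path_space" for s s'
    by (rule measurable_compose[OF shift_measurable]) measurable
  let ?h = "\<lambda>s. \<integral>\<^sup>+x. G (\<lambda>t. x (t + s)) (- s) * of_bool (x s) \<partial>N"
  have "(\<integral>\<^sup>+x. (\<integral>\<^sup>+s. G x s * of_bool (x s) \<partial>count_space UNIV) \<partial>N) =
    (\<integral>\<^sup>+s. (\<integral>\<^sup>+x. G x s * of_bool (x s) \<partial>N) \<partial>count_space UNIV)"
    by (rule nn_integral_count_space_nn_integral) auto
  also have "\<dots> = (\<integral>\<^sup>+s. ?h (- s) \<partial>count_space UNIV)"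
  proof (rule nn_integral_cong)
    fix s show "(\<integral>\<^sup>+x. G x s * of_bool (x s) \<partial>N) = ?h (- s)"
      using palm_shift[of "\<lambda>x. G x s" s] by simp
  qed
  also have "\<dots> = (\<integral>\<^sup>+s. ?h s \<partial>count_space UNIV)"
    by (rule nn_integral_bij_count_space) (rule bij_uminus)
  also have "\<dots> = (\<integral>\<^sup>+x. (\<integral>\<^sup>+s. G (\<lambda>t. x (t + s)) (- s) * of_bool (x s) \<partial>count_space UNIV) \<partial>N)"
    by (rule nn_integral_count_space_nn_integral[symmetric]) auto
  finally show ?thesis .
qed

text \<open>The origin sends mass only if a first point exists. It receives mass only if it is the
  first point, and then the same amount from every point of the cluster, itself included.\<close>

lemma nn_integral_first_point_transport:
  assumes [measurable]: "\<psi> \<in> borel_measurable borel"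
  shows "(\<integral>\<^sup>+x. \<psi> (npoints UNIV x) * of_bool (npoints {..<0} x < \<infinity>) \<partial>N) =
    (\<integral>\<^sup>+x. npoints UNIV x * \<psi> (npoints UNIV x) * of_bool (npoints {..<0} x = 0) \<partial>N)"
proof -
  \<comment> \<open>That s is a point is left out here, since \<open>mass_transport\<close> supplies
    the factor \<open>of_bool (x s)\<close>.\<close>
  define G where "G x s = \<psi> (npoints UNIV x) * of_bool (\<forall>t<s. \<not> x t)" for x and s :: int
  have [measurable]: "(\<lambda>x. G x s) \<in> borel_measurable path_space" for s
    unfolding G_def by measurable
  have "(\<integral>\<^sup>+x. \<psi> (npoints UNIV x) * of_bool (npoints {..<0} x < \<infinity>) \<partial>N) =
    (\<integral>\<^sup>+x. (\<integral>\<^sup>+s. G x s * of_bool (x s) \<partial>count_space UNIV) \<partial>N)"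
  proof (rule nn_integral_cong_AE, use AE_origin in eventually_elim)
    fix x :: "int \<Rightarrow> bool" assume "x 0"
    have "(\<integral>\<^sup>+s. G x s * of_bool (x s) \<partial>count_space UNIV) =
      (\<integral>\<^sup>+s. \<psi> (npoints UNIV x) * of_bool (x s \<and> (\<forall>t<s. \<not> x t)) \<partial>count_space UNIV)"
      by (rule nn_integral_cong) (auto simp: G_def)
    also have "\<dots> = \<psi> (npoints UNIV x) * of_bool (npoints {..<0} x < \<infinity>)"
      unfolding nn_integral_first_point[of x, OF \<open>x 0\<close>, symmetric] by (rule nn_integral_cmult) simp
    finally show "\<psi> (npoints UNIV x) * of_bool (npoints {..<0} x < \<infinity>) =
      (\<integral>\<^sup>+s. G x s * of_bool (x s) \<partial>count_space UNIV)" by simp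
  qed
  also have "\<dots> = (\<integral>\<^sup>+x. (\<integral>\<^sup>+s. G (\<lambda>t. x (t + s)) (- s) * of_bool (x s) \<partial>count_space UNIV) \<partial>N)"
    by (rule mass_transport) measurable
  also have "\<dots> = (\<integral>\<^sup>+x. npoints UNIV x * \<psi> (npoints UNIV x) * of_bool (npoints {..<0} x = 0) \<partial>N)"
  proof (rule nn_integral_cong)
    fix x :: "int \<Rightarrow> bool"
    \<comment> \<open>The cluster size is shift invariant, and s aims at the origin exactly when no
      point lies to the left of the origin; the amount therefore does not depend on s.\<close>
    have "G (\<lambda>t. x (t + s)) (- s) = \<psi> (npoints UNIV x) * of_bool (npoints {..<0} x = 0)" for s
    proof -
      have "(\<forall>t. t < - s \<longrightarrow> \<not> x (t + s)) \<longleftrightarrow> (\<forall>t<0. \<not> x t)"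
      proof (intro iffI allI impI)
        fix t :: int assume "\<forall>t. t < - s \<longrightarrow> \<not> x (t + s)" "t < 0"
        from this(1)[rule_format, of "t - s"] this(2) show "\<not> x t" by simp
      next
        fix t assume "\<forall>t<0. \<not> x t" "t < - s"
        from this(1)[rule_format, of "t + s"] this(2) show "\<not> x (t + s)" by simp
      qed
      moreover have "surj (\<lambda>t. t + s)"
        by (rule surjI[of _ "\<lambda>t. t - s"]) simp
      moreover have "npoints {..<0} x = 0 \<longleftrightarrow> (\<forall>t<0. \<not> x t)"
        by (auto simp: npoints_eq_0_iff)
      ultimately show ?thesis
        by (simp add: G_def npoints_image[of "\<lambda>t. t + s" UNIV x])
    qed
    then have "(\<integral>\<^sup>+s. G (\<lambda>t. x (t + s)) (- s) * of_bool (x s) \<partial>count_space UNIV) =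
      (\<integral>\<^sup>+s. \<psi> (npoints UNIV x) * of_bool (npoints {..<0} x = 0) * indicator {s \<in> UNIV. x s} s \<partial>count_space UNIV)"
      by (intro nn_integral_cong) (simp add: indicator_def)
    also have "\<dots> = \<psi> (npoints UNIV x) * of_bool (npoints {..<0} x = 0) * npoints UNIV x"
      by (subst nn_integral_cmult) (simp_all add: npoints_def)
    finally show "(\<integral>\<^sup>+s. G (\<lambda>t. x (t + s)) (- s) * of_bool (x s) \<partial>count_space UNIV) =
      npoints UNIV x * \<psi> (npoints UNIV x) * of_bool (npoints {..<0} x = 0)"
      by (simp add: mult_ac)
  qed
  finally show ?thesis .
qed

text \<open>The origin has a k-th successor iff at least k points lie to its right, and it is the
  k-th successor of some point iff at least k points lie to its left.\<close>

lemma emeasure_npoints_ge: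
  "emeasure N {x. of_nat k \<le> npoints {0<..} x} = emeasure N {x. of_nat k \<le> npoints {..<0} x}"
proof (cases "k = 0")
  case False
  then have "k > 0" by simp
  define G where "G x s = (of_bool (0 < s \<and> npoints {0<..s} x = of_nat k) :: ennreal)" for x and s :: int
  have [measurable]: "(\<lambda>x. G x s) \<in> borel_measurable path_space" for s
    unfolding G_def by measurable
  have "emeasure N {x. of_nat k \<le> npoints {0<..} x} = (\<integral>\<^sup>+x. of_bool (of_nat k \<le> npoints {0<..} x) \<partial>N)"
    by (simp add: emeasure_eq_nn_integral)
  also have "\<dots> = (\<integral>\<^sup>+x. (\<integral>\<^sup>+s. G x s * of_bool (x s) \<partial>count_space UNIV) \<partial>N)"
    unfolding nn_integral_kth_point[OF \<open>k > 0\<close>, symmetric]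
    by (intro nn_integral_cong) (auto simp: G_def)
  also have "\<dots> = (\<integral>\<^sup>+x. (\<integral>\<^sup>+s. G (\<lambda>t. x (t + s)) (- s) * of_bool (x s) \<partial>count_space UNIV) \<partial>N)"
    by (rule mass_transport) measurable
  also have "\<dots> = (\<integral>\<^sup>+x. of_bool (of_nat k \<le> npoints {..<0} x) \<partial>N)"
  proof (rule nn_integral_cong_AE, use AE_origin in eventually_elim)
    fix x :: "int \<Rightarrow> bool" assume "x 0"
    \<comment> \<open>Reflection turns predecessors into successors, so that
      \<open>nn_integral_kth_point\<close> also evaluates the mass received.\<close>
    define y where "y t = x (- t)" for t
    have npy: "npoints A y = npoints (uminus ` A) x" for A
      unfolding y_def by (rule npoints_image) simp
    \<comment> \<open>Counting from s includes the origin but not s; counting back from the origin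
      includes s but not the origin. As both are points, the numbers agree.\<close>
    have "npoints {0<..- s} (\<lambda>t. x (t + s)) = npoints {0<..- s} y" if "x s" "s < 0" for s
    proof -
      have fin: "finite {t \<in> {s<..<0}. x t}"
        by (rule finite_subset[of _ "{s<..<0}"]) auto
      have "npoints {0<..- s} (\<lambda>t. x (t + s)) = npoints {s<..0} x"
      proof -
        have "(\<lambda>t. t + s) ` {0<..- s} = {s<..0}"
        proof (intro equalityI subsetI)
          fix t assume "t \<in> {s<..0}"
          then show "t \<in> (\<lambda>t. t + s) ` {0<..- s}"
            by (intro image_eqI[of _ _ "t - s"]) auto
        qed auto
        then show ?thesis
          using npoints_image[of "\<lambda>t. t + s" "{0<..- s}" x] by simp
      qed
      also have "{t \<in> {s<..0}. x t} = insert 0 {t \<in> {s<..<0}. x t}"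
        using \<open>x 0\<close> that by (auto simp: le_less)
      then have "npoints {s<..0} x = of_nat (Suc (card {t \<in> {s<..<0}. x t}))"
        using fin by (simp add: npoints_def)
      also have "{t \<in> {s..<0}. x t} = insert s {t \<in> {s<..<0}. x t}"
        using that by (auto simp: le_less)
      then have "of_nat (Suc (card {t \<in> {s<..<0}. x t})) = npoints {s..<0} x"
        using fin by (simp add: npoints_def)
      finally show ?thesis
        by (simp add: npy)
    qed
    then have "(\<integral>\<^sup>+s. G (\<lambda>t. x (t + s)) (- s) * of_bool (x s) \<partial>count_space UNIV) =
      (\<integral>\<^sup>+s. of_bool (0 < - s \<and> y (- s) \<and> npoints {0<..- s} y = of_nat k) \<partial>count_space UNIV)"
      by (intro nn_integral_cong) (auto simp: G_def y_def)
    also have "\<dots> = (\<integral>\<^sup>+s. of_bool (0 < s \<and> y s \<and> npoints {0<..s} y = of_nat k) \<partial>count_space UNIV)"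
      by (rule nn_integral_bij_count_space) (rule bij_uminus)
    also have "\<dots> = of_bool (of_nat k \<le> npoints {..<0} x)"
      by (subst nn_integral_kth_point[OF \<open>k > 0\<close>]) (simp add: npy)
    finally show "(\<integral>\<^sup>+s. G (\<lambda>t. x (t + s)) (- s) * of_bool (x s) \<partial>count_space UNIV) =
      of_bool (of_nat k \<le> npoints {..<0} x)" .
  qed
  also have "\<dots> = emeasure N {x. of_nat k \<le> npoints {..<0} x}"
    by (simp add: emeasure_eq_nn_integral)
  finally show ?thesis .
qed simp

text \<open>Counts are natural or infinite, so the probabilities of having at least k points, for
  all naturals k, determine every ray and thus the law.\<close>

lemma distr_npoints: "distr N borel (npoints {0<..}) = distr N borel (npoints {..<0})"
proof -
  \<comment> \<open>The rays omit 0 and cannot cover the space; \<open>UNIV\<close> is added as the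
    exhausting set that uniqueness of measures asks for.\<close>
  let ?E = "insert UNIV (range greaterThan) :: ennreal set set"
  have borel_E: "sets (borel :: ennreal measure) = sigma_sets UNIV ?E"
  proof -
    have "sets (borel :: ennreal measure) = sigma_sets UNIV (range greaterThan)"
      unfolding borel_Ioi by simp
    also have "\<dots> = sigma_sets UNIV ?E"
      by (rule sigma_sets_eqI) (auto intro: sigma_sets_top)
    finally show ?thesis .
  qed
  have distr_npoints_eq: "emeasure (distr N borel (npoints A)) B = emeasure N {x. npoints A x \<in> B}"
    if "B \<in> sets borel" for A B
    using that by (subst emeasure_distr) (auto simp: vimage_def)
  show ?thesis
  proof (rule measure_eqI_generator_eq[where E="?E" and \<Omega>=UNIV and A="\<lambda>_. UNIV"])
    show "Int_stable ?E"
    proof (rule Int_stableI)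
      fix A B assume "A \<in> ?E" "B \<in> ?E"
      moreover have "{a<..} \<inter> {b<..} = {max a b<..}" for a b :: ennreal
        by auto
      ultimately show "A \<inter> B \<in> ?E"
        by auto
    qed
    fix B :: "ennreal set" assume "B \<in> ?E"
    then consider "B = UNIV" | a where "B = {a<..}"
      by blast
    then show "emeasure (distr N borel (npoints {0<..})) B = emeasure (distr N borel (npoints {..<0})) B"
    proof cases
      case 1
      then show ?thesis
        by (simp add: distr_npoints_eq)
    next
      case (2 a)
      show ?thesis
      proof (cases a)
        case (real r)
        then have "a < \<top>"
          by simp
        \<comment> \<open>The least natural above r: a natural m exceeds r exactly when k \<le>
          m.\<close>
        define k where "k = Suc (nat \<lfloor>r\<rfloor>)"
        have less_k: "a < of_nat m \<longleftrightarrow> k \<le> m" for m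
          using real unfolding k_def ennreal_of_nat_eq_real_of_nat
          by (simp add: ennreal_less_iff) linarith
        have "a < npoints A x \<longleftrightarrow> of_nat k \<le> npoints A x" for A x
          using \<open>a < \<top>\<close> by (cases "finite {t \<in> A. x t}") (simp_all add: npoints_finite npoints_infinite less_k)
        then show ?thesis
          using 2 emeasure_npoints_ge[of k] by (simp add: distr_npoints_eq)
      next
        case top
        then show ?thesis
          using 2 by (simp add: distr_npoints_eq)
      qed
    qed
  qed (auto simp: borel_E distr_npoints_eq emeasure_eq_measure)
qed

subsection \<open>Cluster sizes\<close>

lemma AE_total: "AE x in N. ntotal x = 1 + nright x + nleft x"
  using AE_origin
proof eventually_elim
  fix x :: "int \<Rightarrow> bool" assume "x 0"
  have "{t \<in> UNIV. x t} = {0} \<union> ({t \<in> {0<..}. x t} \<union> {t \<in> {..<0}. x t})"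
    using \<open>x 0\<close> by force
  then have "ntotal x = emeasure (count_space UNIV) ({0} \<union> ({t \<in> {0<..}. x t} \<union> {t \<in> {..<0}. x t}))"
    unfolding npoints_def by (rule arg_cong)
  also have "\<dots> = emeasure (count_space UNIV) {0::int} +
      emeasure (count_space UNIV) ({t \<in> {0<..}. x t} \<union> {t \<in> {..<0}. x t})"
    by (rule plus_emeasure[symmetric]) auto
  also have "emeasure (count_space UNIV) ({t \<in> {0<..}. x t} \<union> {t \<in> {..<0}. x t}) = nright x + nleft x"
    unfolding npoints_def by (rule plus_emeasure[symmetric]) auto
  finally show "ntotal x = 1 + nright x + nleft x"
    by (simp add: add.assoc)
qed

lemma prob_right_left:
  assumes "B \<in> sets borel"
  shows "prob {x. nright x \<in> B} = prob {x. nleft x \<in> B}"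
proof -
  have "measure (distr N borel nright) B = measure (distr N borel nleft) B"
    by (simp add: distr_npoints)
  then show ?thesis
    using assms by (simp add: measure_distr vimage_def)
qed

text \<open>Here \<psi> is the indicator of \<infinity>. One side of the transport is a probability,
  the other integrates a function with values 0 and \<infinity> only; being finite it vanishes, and
  so does the probability.\<close>

lemma AE_left_finite_imp_total_finite: "AE x in N. nleft x < \<infinity> \<longrightarrow> ntotal x < \<infinity>"
proof -
  let ?\<psi> = "\<lambda>s :: ennreal. of_bool (s = \<infinity>) :: ennreal"
  have transport: "(\<integral>\<^sup>+x. ?\<psi> (ntotal x) * of_bool (nleft x < \<infinity>) \<partial>N) =
    (\<integral>\<^sup>+x. ntotal x * ?\<psi> (ntotal x) * of_bool (nleft x = 0) \<partial>N)"
    by (rule nn_integral_first_point_transport) measurable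
  have "(\<integral>\<^sup>+x. ?\<psi> (ntotal x) * of_bool (nleft x < \<infinity>) \<partial>N) \<le> (\<integral>\<^sup>+x. 1 \<partial>N)"
    by (rule nn_integral_mono) auto
  then have "(\<integral>\<^sup>+x. ntotal x * ?\<psi> (ntotal x) * of_bool (nleft x = 0) \<partial>N) \<noteq> \<infinity>"
    unfolding transport[symmetric] by (auto simp: emeasure_space_1 top_unique)
  then have "AE x in N. ntotal x * ?\<psi> (ntotal x) * of_bool (nleft x = 0) \<noteq> \<infinity>"
    by (intro nn_integral_noteq_infinite) measurable
  then have "AE x in N. ntotal x * ?\<psi> (ntotal x) * of_bool (nleft x = 0) = 0"
    by eventually_elim (auto split: if_splits simp: of_bool_def)
  then have "(\<integral>\<^sup>+x. ?\<psi> (ntotal x) * of_bool (nleft x < \<infinity>) \<partial>N) = 0"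
    unfolding transport by (subst nn_integral_0_iff_AE) auto
  then have "AE x in N. ?\<psi> (ntotal x) * of_bool (nleft x < \<infinity>) = 0"
    by (subst (asm) nn_integral_0_iff_AE) measurable
  then show ?thesis
    by eventually_elim (auto simp: less_top[symmetric])
qed

text \<open>Up to a null set the total is finite exactly when the left count is, and left and right
  counts have the same law.\<close>

lemma prob_total_finite: "prob {x. ntotal x < \<infinity>} = prob {x. nright x < \<infinity>}"
proof -
  have "prob {x. ntotal x < \<infinity>} = prob {x. nleft x < \<infinity>}"
  proof (rule finite_measure_eq_AE)
    show "AE x in N. x \<in> {x. ntotal x < \<infinity>} \<longleftrightarrow> x \<in> {x. nleft x < \<infinity>}"
      using AE_total AE_left_finite_imp_total_finite by eventually_elim auto
  qed (auto intro!: pred_N_sets)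
  also have "\<dots> = prob {x. nright x < \<infinity>}"
    using prob_right_left[of "{..<\<infinity>}"] by simp
  finally show ?thesis .
qed

lemma prob_eq_infinity: 
  "prob {x. npoints A x = \<infinity>} = 1 \<longleftrightarrow> prob {x. npoints A x < \<infinity>} = 0"
proof -
  have "{x. npoints A x < \<infinity>} \<in> events"
    by (rule pred_N_sets) measurable
  from prob_compl[OF this] have "prob {x. npoints A x = \<infinity>} = 1 - prob {x. npoints A x < \<infinity>}"
    by (simp add: Compl_eq_Diff_UNIV[symmetric] Collect_neg_eq[symmetric] less_top[symmetric])
  then show ?thesis by simp
qed

text \<open>The transport with \<psi> = 1; division by P(S_- = 0) turns the left side into
  E(S^t).\<close>

lemma nn_integral_total_left_0:
  "(\<integral>\<^sup>+x. ntotal x * of_bool (nleft x = 0) \<partial>N) = prob {x. nright x < \<infinity>}"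
proof -
  have "(\<integral>\<^sup>+x. ntotal x * of_bool (nleft x = 0) \<partial>N) = (\<integral>\<^sup>+x. of_bool (nleft x < \<infinity>) \<partial>N)"
    using nn_integral_first_point_transport[of "\<lambda>_. 1"] by simp
  also have "\<dots> = prob {x. nleft x < \<infinity>}"
    by (simp flip: emeasure_eq_nn_integral emeasure_eq_measure)
  also have "\<dots> = prob {x. nright x < \<infinity>}"
    using prob_right_left[of "{..<\<infinity>}"] by simp
  finally show ?thesis .
qed

text \<open>If S_- = 0 had probability 0, the integral in \<open>nn_integral_total_left_0\<close>
  would vanish, whereas it equals the probability of a finite right count.\<close>

lemma prob_right_0_pos_iff: "prob {x. nright x = 0} > 0 \<longleftrightarrow> prob {x. nright x < \<infinity>} > 0"
proof
  assume "prob {x. nright x = 0} > 0"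
  also have "prob {x. nright x = 0} \<le> prob {x. nright x < \<infinity>}"
    by (rule finite_measure_mono) (auto intro: pred_N_sets)
  finally show "prob {x. nright x < \<infinity>} > 0" .
next
  assume pos: "prob {x. nright x < \<infinity>} > 0"
  have "prob {x. nleft x = 0} \<noteq> 0"
  proof
    assume "prob {x. nleft x = 0} = 0"
    then have nz: "AE x in N. nleft x \<noteq> 0"
      by (subst (asm) prob_eq_0) (auto intro: pred_N_sets)
    have "(\<integral>\<^sup>+x. ntotal x * of_bool (nleft x = 0) \<partial>N) = (\<integral>\<^sup>+x. 0 \<partial>N)"
      by (rule nn_integral_cong_AE) (use nz in eventually_elim, simp)
    with pos show False
      by (simp add: nn_integral_total_left_0)
  qed
  with prob_right_left[of "{0}"] show "prob {x. nright x = 0} > 0"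
    by (simp add: zero_less_measure_iff)
qed

lemma nn_integral_total: "(\<integral>\<^sup>+x. ntotal x \<partial>N) = 1 + 2 * (\<integral>\<^sup>+x. nright x \<partial>N)"
proof -
  have "(\<integral>\<^sup>+x. nright x \<partial>N) = (\<integral>\<^sup>+s. s \<partial>distr N borel nright)"
    by (subst nn_integral_distr) auto
  also have "\<dots> = (\<integral>\<^sup>+x. nleft x \<partial>N)"
    unfolding distr_npoints by (subst nn_integral_distr) auto
  finally have right_left: "(\<integral>\<^sup>+x. nright x \<partial>N) = (\<integral>\<^sup>+x. nleft x \<partial>N)" .
  have "(\<integral>\<^sup>+x. ntotal x \<partial>N) = (\<integral>\<^sup>+x. 1 + nright x + nleft x \<partial>N)"
    by (rule nn_integral_cong_AE) (rule AE_total)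
  also have "\<dots> = 1 + (\<integral>\<^sup>+x. nright x \<partial>N) + (\<integral>\<^sup>+x. nleft x \<partial>N)"
    by (simp add: nn_integral_add emeasure_space_1[simplified])
  finally show ?thesis
    by (simp add: right_left mult_2 add.assoc)
qed

section \<open>Clusters that are finite almost surely\<close>

context
  assumes right_finite: "prob {x. nright x < \<infinity>} = 1"
begin

lemma AE_left_finite: "AE x in N. nleft x < \<infinity>"
proof -
  have "prob {x. nleft x < \<infinity>} = 1"
    using prob_right_left[of "{..<\<infinity>}"] right_finite by simp
  then show ?thesis
    using prob_Collect_eq_1[of "\<lambda>x. nleft x < \<infinity>"] pred_N_sets[of "\<lambda>x. nleft x < \<infinity>"] by simp
qed

lemma AE_total_finite: "AE x in N. ntotal x < \<infinity>"
  using AE_left_finite AE_left_finite_imp_total_finite by eventually_elim simp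

text \<open>The transport with \<psi> = s, a size-biasing that turns the second moment of S^t into
  the first moment of S. Almost sure finiteness removes the indicator on the sending side.\<close>

lemma nn_integral_total_squared_left_0:
  "(\<integral>\<^sup>+x. (ntotal x)\<^sup>2 * of_bool (nleft x = 0) \<partial>N) = (\<integral>\<^sup>+x. ntotal x \<partial>N)"
proof -
  have "(\<integral>\<^sup>+x. ntotal x \<partial>N) = (\<integral>\<^sup>+x. ntotal x * of_bool (nleft x < \<infinity>) \<partial>N)"
    by (rule nn_integral_cong_AE) (use AE_left_finite in eventually_elim, simp)
  also have "\<dots> = (\<integral>\<^sup>+x. (ntotal x)\<^sup>2 * of_bool (nleft x = 0) \<partial>N)"
    using nn_integral_first_point_transport[of "\<lambda>s. s"] by (simp add: power2_eq_square)
  finally show ?thesis by simp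
qed

text \<open>The transport with \<psi> = 1/s. It identifies \<theta> as E(1/S), so that 1/\<theta> is
  the harmonic mean of S.\<close>

lemma nn_integral_inverse_total: "(\<integral>\<^sup>+x. inverse (ntotal x) \<partial>N) = prob {x. nright x = 0}"
proof -
  have "(\<integral>\<^sup>+x. inverse (ntotal x) \<partial>N) = (\<integral>\<^sup>+x. inverse (ntotal x) * of_bool (nleft x < \<infinity>) \<partial>N)"
    by (rule nn_integral_cong_AE) (use AE_left_finite in eventually_elim, simp)
  also have "\<dots> = (\<integral>\<^sup>+x. ntotal x * inverse (ntotal x) * of_bool (nleft x = 0) \<partial>N)"
    by (rule nn_integral_first_point_transport) measurable
  also have "\<dots> = (\<integral>\<^sup>+x. of_bool (nleft x = 0) \<partial>N)"
  proof (rule nn_integral_cong_AE, use AE_total AE_total_finite in eventually_elim)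
    \<comment> \<open>The cancellation uses 1 \<le> S < \<infinity>; for S = \<infinity> the product
      would be 0.\<close>
    fix x :: "int \<Rightarrow> bool" assume ntotal: "ntotal x = 1 + nright x + nleft x" "ntotal x < \<infinity>"
    then have "ntotal x * inverse (ntotal x) = 1"
      by (simp flip: divide_ennreal_def)
    then show "ntotal x * inverse (ntotal x) * of_bool (nleft x = 0) = of_bool (nleft x = 0)"
      by simp
  qed
  also have "\<dots> = prob {x. nleft x = 0}"
    by (simp flip: emeasure_eq_nn_integral emeasure_eq_measure)
  also have "\<dots> = prob {x. nright x = 0}"
    using prob_right_left[of "{0}"] by simp
  finally show ?thesis .
qed

end

text \<open>The harmonic mean of S is 1/\<theta> by \<open>nn_integral_inverse_total\<close>.
  Equality of the means makes S almost surely constant, and a constant value of a finite count is a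
  natural number.\<close>

lemma harmonic_mean_total:
  assumes right_finite: "prob {x. nright x < \<infinity>} = 1" and pos: "prob {x. nright x = 0} > 0"
  defines "\<theta> \<equiv> prob {x. nright x = 0}"
  shows "ennreal (1 / \<theta>) \<le> (\<integral>\<^sup>+x. ntotal x \<partial>N)"
    and "ennreal (1 / \<theta>) = (\<integral>\<^sup>+x. ntotal x \<partial>N) \<Longrightarrow> \<exists>k::nat. k \<ge> 1 \<and> prob {x. ntotal x = of_nat k} = 1"
proof -
  define f where "f x = enn2real (ntotal x)" for x
  have [measurable]: "f \<in> borel_measurable N"
    unfolding f_def by measurable
  have f: "AE x in N. ntotal x = ennreal (f x) \<and> f x \<ge> 1"
    using AE_total AE_total_finite[OF right_finite]
  proof eventually_elim
    fix x :: "int \<Rightarrow> bool" assume *: "ntotal x = 1 + nright x + nleft x" "ntotal x < \<infinity>"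
    then have eq: "ntotal x = ennreal (f x)"
      by (simp add: f_def)
    moreover have "ennreal 1 \<le> ntotal x"
      unfolding *(1) by (simp add: add.assoc)
    then have "1 \<le> f x"
      unfolding eq by (subst (asm) ennreal_le_iff) (simp_all add: f_def)
    ultimately show "ntotal x = ennreal (f x) \<and> f x \<ge> 1" ..
  qed
  have "(\<integral>\<^sup>+x. ennreal (1 / f x) \<partial>N) = (\<integral>\<^sup>+x. inverse (ntotal x) \<partial>N)"
    by (rule nn_integral_cong_AE) (use f in eventually_elim, auto simp: inverse_ennreal divide_inverse)
  also have "\<dots> = ennreal \<theta>"
    unfolding \<theta>_def by (rule nn_integral_inverse_total[OF right_finite])
  finally have inv: "(\<integral>\<^sup>+x. ennreal (1 / f x) \<partial>N) = ennreal \<theta>" .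
  have inv_nonneg: "AE x in N. 0 \<le> 1 / f x"
    using f by eventually_elim simp
  have int_inv: "integrable N (\<lambda>x. 1 / f x)"
    by (rule integrableI_nonneg) (use inv inv_nonneg in auto)
  have "ennreal (expectation (\<lambda>x. 1 / f x)) = ennreal \<theta>"
    using nn_integral_eq_integral[OF int_inv inv_nonneg] inv by simp
  then have exp_inv: "expectation (\<lambda>x. 1 / f x) = \<theta>"
    using integral_nonneg_AE[OF inv_nonneg] pos by (simp add: \<theta>_def)
  have total_f: "(\<integral>\<^sup>+x. ntotal x \<partial>N) = (\<integral>\<^sup>+x. ennreal (f x) \<partial>N)"
    by (rule nn_integral_cong_AE) (use f in eventually_elim, simp)
  have f_pos: "AE x in N. f x > 0"
    using f by eventually_elim simp
  have f_nonneg: "AE x in N. 0 \<le> f x"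
    using f by eventually_elim simp
  have *: "integrable N f" "(\<integral>\<^sup>+x. ntotal x \<partial>N) = ennreal (expectation f)" if "(\<integral>\<^sup>+x. ntotal x \<partial>N) < \<infinity>"
  proof -
    show "integrable N f"
      by (rule integrableI_nonneg) (use f_nonneg that total_f in auto)
    then show "(\<integral>\<^sup>+x. ntotal x \<partial>N) = ennreal (expectation f)"
      unfolding total_f by (rule nn_integral_eq_integral) (rule f_nonneg)
  qed
  show "ennreal (1 / \<theta>) \<le> (\<integral>\<^sup>+x. ntotal x \<partial>N)"
  proof (cases "(\<integral>\<^sup>+x. ntotal x \<partial>N) < \<infinity>")
    case True
    show ?thesis
      using harmonic_mean_le_expectation(1)[OF *(1)[OF True] int_inv f_pos]
      unfolding *(2)[OF True] exp_inv by (rule ennreal_leI)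
  next
    case False
    then have "(\<integral>\<^sup>+x. ntotal x \<partial>N) = \<infinity>"
      by (simp add: not_less top_unique)
    then show ?thesis by simp
  qed
  assume eq: "ennreal (1 / \<theta>) = (\<integral>\<^sup>+x. ntotal x \<partial>N)"
  \<comment> \<open>Equality itself forces a finite expectation, as 1/\<theta> is a real
    number.\<close>
  then have fin: "(\<integral>\<^sup>+x. ntotal x \<partial>N) < \<infinity>"
    by (metis ennreal_less_top infinity_ennreal_def)
  have "1 / \<theta> = expectation f"
    using eq integral_nonneg_AE[OF f_nonneg] pos unfolding *(2)[OF fin] by (simp add: \<theta>_def)
  then have "AE x in N. f x = expectation f"
    using harmonic_mean_le_expectation(2)[OF *(1)[OF fin] int_inv f_pos] unfolding exp_inv by blast
  then have total: "AE x in N. ntotal x = ennreal (expectation f) \<and> 1 \<le> ntotal x \<and> ntotal x < \<infinity>"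
    using f by eventually_elim auto
  \<comment> \<open>An almost sure property holds somewhere; the point count of one such
    configuration exhibits the constant as a natural number.\<close>
  have "\<exists>x. ntotal x = ennreal (expectation f) \<and> 1 \<le> ntotal x \<and> ntotal x < \<infinity>"
  proof (rule ccontr)
    assume no: "\<nexists>x. ntotal x = ennreal (expectation f) \<and> 1 \<le> ntotal x \<and> ntotal x < \<infinity>"
    from total have "AE x in N. False"
      by eventually_elim (use no in blast)
    then show False by simp
  qed
  then obtain x where x: "ntotal x = ennreal (expectation f)" "1 \<le> ntotal x" "ntotal x < \<infinity>"
    by blast
  define k where "k = card {t \<in> UNIV. x t}"
  have k: "ntotal x = of_nat k"
    using x(3) unfolding k_def by (intro npoints_finite) (simp add: npoints_less_top_iff)
  have "of_nat 1 \<le> (of_nat k :: ennreal)"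
    using x(2) unfolding k by simp
  then have "1 \<le> k"
    by (rule of_nat_le_iff[THEN iffD1])
  moreover have "AE y in N. ntotal y = of_nat k"
    using total by eventually_elim (simp add: x(1)[symmetric] k)
  then have "prob {x. ntotal x = of_nat k} = 1"
    using prob_Collect_eq_1[of "\<lambda>x. ntotal x = of_nat k"] pred_N_sets[of "\<lambda>x. ntotal x = of_nat k"]
    by simp
  ultimately show "\<exists>k::nat. k \<ge> 1 \<and> prob {x. ntotal x = of_nat k} = 1"
    by blast
qed

end

subsection \<open>Limits of conditioned stationary processes\<close>

lemma measurable_window [measurable]:
  assumes [measurable]: "\<And>t. X t \<in> borel_measurable M"
  shows "window X u v \<in> borel_measurable M"
proof (rule measurable_coordinatewise_then_product)
  fix t show "(\<lambda>\<omega>. window X u v \<omega> t) \<in> borel_measurable M"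
    unfolding window_def by (cases "- int u \<le> t \<and> t \<le> int v") simp_all
qed

lemma window_apply: "\<bar>t\<bar> \<le> int u \<Longrightarrow> window X u u \<omega> t = X t \<omega>"
  by (simp add: window_def abs_le_iff)

text \<open>The bound is at least 1 because convergence is assumed only for windows with both arms
  of length at least 1.\<close>

lemma finite_int_set_bounded:
  assumes "finite (J :: int set)"
  obtains u :: nat where "u \<ge> 1" "\<And>j. j \<in> J \<Longrightarrow> \<bar>j\<bar> \<le> int u"
proof
  define u where "u = Suc (nat (\<Sum>j\<in>J. \<bar>j\<bar>))"
  show "u \<ge> 1"
    by (simp add: u_def)
  fix j assume "j \<in> J"
  then have "\<bar>j\<bar> \<le> (\<Sum>j\<in>J. \<bar>j\<bar>)"
    using assms by (intro member_le_sum) auto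
  then show "\<bar>j\<bar> \<le> int u"
    by (simp add: u_def)
qed

text \<open>A continuous substitute for the indicator of B, with 1 read as True and 0 as False and
  linear in between; convergence in distribution admits continuous test functions only.\<close>

definition unit_interp :: "bool set \<Rightarrow> real \<Rightarrow> real" where
  "unit_interp B r = of_bool (True \<in> B) * max 0 (min 1 r) + of_bool (False \<in> B) * (1 - max 0 (min 1 r))"

lemma unit_interp_01: "r \<in> {0, 1} \<Longrightarrow> unit_interp B r = of_bool ((r = 1) \<in> B)"
  by (auto simp: unit_interp_def)

lemma unit_interp_bounds: "0 \<le> unit_interp B r" "unit_interp B r \<le> 1"
  by (auto simp: unit_interp_def max_def min_def)

lemma continuous_unit_interp [continuous_intros]:
  "continuous_on S f \<Longrightarrow> continuous_on S (\<lambda>x. unit_interp B (f x))"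
  unfolding unit_interp_def by (intro continuous_intros)

lemma prod_unit_interp_window:
  assumes "finite J" "\<And>j. j \<in> J \<Longrightarrow> \<bar>j\<bar> \<le> int u" "\<And>j. j \<in> J \<Longrightarrow> X j \<omega> \<in> {0, 1}"
  shows "(\<Prod>j\<in>J. unit_interp (A j) (window X u u \<omega> j)) = of_bool (\<forall>j\<in>J. (X j \<omega> = 1) \<in> A j)"
  using assms
proof (induction J)
  case (insert i J)
  then have "(\<Prod>j\<in>J. unit_interp (A j) (window X u u \<omega> j)) = of_bool (\<forall>j\<in>J. (X j \<omega> = 1) \<in> A j)"
    by blast
  moreover have "unit_interp (A i) (window X u u \<omega> i) = of_bool ((X i \<omega> = 1) \<in> A i)"
    using window_apply[of i u X \<omega>] unit_interp_01[of "X i \<omega>" "A i"] insert.prems by simp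
  ultimately show ?case
    using insert.hyps by simp
qed simp

lemma pred_all_finite:
  fixes X :: "int \<Rightarrow> 'a \<Rightarrow> real"
  assumes "finite J" and [measurable]: "\<And>t. X t \<in> borel_measurable P"
  shows "Measurable.pred P (\<lambda>\<omega>. \<forall>j\<in>J. (X j \<omega> = 1) \<in> A j)"
proof (rule pred_intros_finite(3)[OF assms(1)])
  fix j
  show "Measurable.pred P (\<lambda>\<omega>. (X j \<omega> = 1) \<in> A j)"
  proof (rule measurable_compose[of "\<lambda>\<omega>. X j \<omega> = 1"])
    show "Measurable.pred P (\<lambda>\<omega>. X j \<omega> = 1)"
      by measurable
  qed simp
qed

lemma measure_distr_window:
  assumes J: "finite J" "\<And>j. j \<in> J \<Longrightarrow> \<bar>j\<bar> \<le> int u" and X: "\<And>t. X t \<in> borel_measurable P"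
  shows "measure (distr P borel (window X u u)) {y. \<forall>j\<in>J. (y j = 1) \<in> A j} =
    measure P {\<omega> \<in> space P. \<forall>j\<in>J. (X j \<omega> = 1) \<in> A j}"
proof -
  have "Measurable.pred borel (\<lambda>y :: int \<Rightarrow> real. \<forall>j\<in>J. (y j = 1) \<in> A j)"
    by (rule pred_all_finite[OF J(1)]) simp
  from predE[OF this] have "{y :: int \<Rightarrow> real. \<forall>j\<in>J. (y j = 1) \<in> A j} \<in> sets borel"
    by (simp only: space_borel UNIV_I simp_thms)
  then have "measure (distr P borel (window X u u)) {y. \<forall>j\<in>J. (y j = 1) \<in> A j} =
    measure P (window X u u -` {y. \<forall>j\<in>J. (y j = 1) \<in> A j} \<inter> space P)"
    by (rule measure_distr[OF measurable_window[OF X]])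
  also have "(\<forall>j\<in>J. (window X u u \<omega> j = 1) \<in> A j) \<longleftrightarrow> (\<forall>j\<in>J. (X j \<omega> = 1) \<in> A j)" for \<omega>
    by (intro ball_cong refl) (simp only: window_apply[OF J(2)])
  then have "window X u u -` {y. \<forall>j\<in>J. (y j = 1) \<in> A j} \<inter> space P =
    {\<omega> \<in> space P. \<forall>j\<in>J. (X j \<omega> = 1) \<in> A j}"
    unfolding vimage_def mem_Collect_eq by blast
  finally show ?thesis .
qed

text \<open>A sum of nonnegative terms is the supremum of its finite partial sums, and a countable
  set has only countably many finite subsets.\<close>

lemma borel_measurable_infsum_ennreal:
  fixes f :: "'i \<Rightarrow> 'a \<Rightarrow> ennreal"
  assumes "countable A" and [measurable]: "\<And>t. f t \<in> borel_measurable M"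
  shows "(\<lambda>\<omega>. \<Sum>\<^sub>\<infinity>t\<in>A. f t \<omega>) \<in> borel_measurable M"
proof -
  have "(\<lambda>\<omega>. SUP F\<in>{F. finite F \<and> F \<subseteq> A}. sum (\<lambda>t. f t \<omega>) F) \<in> borel_measurable M"
    by (intro borel_measurable_SUP countable_Collect_finite_subset borel_measurable_sum assms)
  then show ?thesis
    unfolding nonneg_infsum_complete[OF zero_le] .
qed

locale conditional_limit = prob_space M
  for M :: "'a measure" and I :: "int \<Rightarrow> 'a \<Rightarrow> real"
    and Mn :: "nat \<Rightarrow> 'b measure" and In :: "nat \<Rightarrow> int \<Rightarrow> 'b \<Rightarrow> real" +
  assumes I_meas [measurable]: "\<And>t. I t \<in> borel_measurable M"
    and prob_Mn: "\<And>n. prob_space (Mn n)"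
    and In_meas [measurable]: "\<And>n t. In n t \<in> borel_measurable (Mn n)"
    and In_01: "\<And>n t \<omega>. \<omega> \<in> space (Mn n) \<Longrightarrow> In n t \<omega> \<in> {0, 1}"
    and In_stat: "\<And>n. stationary_process (Mn n) (In n)"
    and In_pos: "\<And>n. measure (Mn n) {\<omega> \<in> space (Mn n). In n 0 \<omega> = 1} > 0"
    and conv: "\<And>u v. u \<ge> 1 \<Longrightarrow> v \<ge> 1 \<Longrightarrow>
       conv_in_distr
         (\<lambda>n. distr (cond_measure (Mn n) {\<omega> \<in> space (Mn n). In n 0 \<omega> = 1}) borel (window (In n) u v))
         (distr M borel (window I u v))"
begin

section \<open>Conditional laws and their limit on cylinders\<close>

abbreviation "origin n \<equiv> {\<omega> \<in> space (Mn n). In n 0 \<omega> = 1}"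
abbreviation "Cn n \<equiv> cond_measure (Mn n) (origin n)"

lemma emeasure_origin: "emeasure (Mn n) (origin n) \<noteq> 0" "emeasure (Mn n) (origin n) < \<infinity>"
proof -
  interpret P: prob_space "Mn n" by (rule prob_Mn)
  show "emeasure (Mn n) (origin n) \<noteq> 0" "emeasure (Mn n) (origin n) < \<infinity>"
    using In_pos[of n] by (auto simp: P.emeasure_eq_measure)
qed

lemma prob_Cn: "prob_space (Cn n)"
  using emeasure_origin[of n] by (intro prob_space_uniform_measure) auto

lemma In_meas_Cn [measurable]: "In n t \<in> borel_measurable (Cn n)"
  using In_meas[of n t] by (simp cong: measurable_cong_sets)

text \<open>Windows symmetric about the origin suffice, since every finite set of sites fits into
  one.\<close>

lemma tendsto_window:
  assumes cont: "continuous_on UNIV f" and bdd: "bounded (range f)" and u: "u \<ge> 1"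
  shows "(\<lambda>n. \<integral>\<omega>. f (window (In n) u u \<omega>) \<partial>Cn n) \<longlonglongrightarrow> (\<integral>\<omega>. (f (window I u u \<omega>) :: real) \<partial>M)"
proof -
  have f: "f \<in> borel_measurable borel"
    by (rule borel_measurable_continuous_onI[OF cont])
  have "(\<integral>x. f x \<partial>distr (Cn n) borel (window (In n) u u)) = (\<integral>\<omega>. f (window (In n) u u \<omega>) \<partial>Cn n)" for n
    by (rule integral_distr[OF measurable_window f]) measurable
  moreover have "(\<integral>x. f x \<partial>distr M borel (window I u u)) = (\<integral>\<omega>. f (window I u u \<omega>) \<partial>M)"
    by (rule integral_distr[OF measurable_window f]) measurable
  ultimately show ?thesis
    using conv[OF u u] cont bdd unfolding conv_in_distr_def by auto
qed

text \<open>The truncation \<open>min 1 g\<close> is an admissible test function.\<close>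

lemma AE_limit:
  assumes cont: "continuous_on UNIV g" and nonneg: "\<And>r. 0 \<le> g r"
    and zero: "\<And>n. AE \<omega> in Cn n. g (In n t \<omega>) = 0"
  shows "AE \<omega> in M. g (I t \<omega>) = (0 :: real)"
proof -
  define u where "u = Suc (nat \<bar>t\<bar>)"
  have u: "u \<ge> 1" "\<bar>t\<bar> \<le> int u"
    by (simp_all add: u_def)
  have [measurable]: "g \<in> borel_measurable borel"
    by (rule borel_measurable_continuous_onI[OF cont])
  let ?f = "\<lambda>x :: int \<Rightarrow> real. min 1 (g (x t))"
  have "(\<lambda>n. \<integral>\<omega>. ?f (window (In n) u u \<omega>) \<partial>Cn n) \<longlonglongrightarrow> (\<integral>\<omega>. ?f (window I u u \<omega>) \<partial>M)"
  proof (rule tendsto_window[OF _ _ u(1)])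
    show "continuous_on UNIV ?f"
      by (intro continuous_intros continuous_on_compose2[OF cont] continuous_on_product_coordinates) auto
    show "bounded (range ?f)"
      using nonneg by (intro boundedI[of _ 1]) (auto simp: abs_le_iff min_def intro: order_trans[of _ 0])
  qed
  moreover have "(\<integral>\<omega>. ?f (window (In n) u u \<omega>) \<partial>Cn n) = 0" for n
    by (rule integral_eq_zero_AE) (use zero[of n] in eventually_elim, simp add: window_apply[OF u(2)])
  ultimately have "(\<integral>\<omega>. min 1 (g (I t \<omega>)) \<partial>M) = 0"
    by (simp add: window_apply[OF u(2)] LIMSEQ_const_iff)
  moreover have "integrable M (\<lambda>\<omega>. min 1 (g (I t \<omega>)))"
    using nonneg by (intro integrable_const_bound[of _ 1]) (auto simp: abs_le_iff min_def intro: order_trans[of _ 0])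
  ultimately have "AE \<omega> in M. min 1 (g (I t \<omega>)) = 0"
    using nonneg by (subst (asm) integral_nonneg_eq_0_iff_AE) auto
  then show ?thesis
    by eventually_elim (simp add: min_def split: if_splits)
qed

text \<open>The function r (r - 1) vanishes exactly at 0 and 1, and its absolute value is an
  admissible \<open>g\<close> in \<open>AE_limit\<close>.\<close>

lemma AE_I_01: "AE \<omega> in M. I t \<omega> \<in> {0, 1}"
proof -
  have "AE \<omega> in M. \<bar>I t \<omega> * (I t \<omega> - 1)\<bar> = 0"
  proof (rule AE_limit)
    show "continuous_on UNIV (\<lambda>r :: real. \<bar>r * (r - 1)\<bar>)"
      by (intro continuous_intros)
    show "AE \<omega> in Cn n. \<bar>In n t \<omega> * (In n t \<omega> - 1)\<bar> = 0" for n
      by (rule AE_I2) (use In_01[of _ n t] in auto)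
  qed simp
  then show ?thesis
    by eventually_elim auto
qed

text \<open>Conditioning forces a point at the origin for every n, and the distance from 1 is a
  continuous function that detects it in the limit.\<close>

lemma AE_I_origin: "AE \<omega> in M. I 0 \<omega> = 1"
proof -
  have "AE \<omega> in M. \<bar>I 0 \<omega> - 1\<bar> = 0"
  proof (rule AE_limit)
    show "continuous_on UNIV (\<lambda>r :: real. \<bar>r - 1\<bar>)"
      by (intro continuous_intros)
    show "AE \<omega> in Cn n. \<bar>In n 0 \<omega> - 1\<bar> = 0" for n
      by (rule AE_uniform_measureI) auto
  qed simp
  then show ?thesis
    by eventually_elim auto
qed

text \<open>A product of interpolations is continuous and bounded, and it equals the cylinder
  indicator on 0/1-valued paths: everywhere for the sequence, almost everywhere for the
  limit.\<close>

lemma tendsto_cylinder: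
  assumes J: "finite J"
  shows "(\<lambda>n. measure (Cn n) {\<omega> \<in> space (Mn n). \<forall>j\<in>J. (In n j \<omega> = 1) \<in> A j}) \<longlonglongrightarrow>
    prob {\<omega> \<in> space M. \<forall>j\<in>J. (I j \<omega> = 1) \<in> A j}"
proof -
  obtain u where u: "u \<ge> 1" "\<And>j. j \<in> J \<Longrightarrow> \<bar>j\<bar> \<le> int u"
    using finite_int_set_bounded[OF J] by blast
  let ?f = "\<lambda>x :: int \<Rightarrow> real. \<Prod>j\<in>J. unit_interp (A j) (x j)"
  have lim: "(\<lambda>n. \<integral>\<omega>. ?f (window (In n) u u \<omega>) \<partial>Cn n) \<longlonglongrightarrow> (\<integral>\<omega>. ?f (window I u u \<omega>) \<partial>M)"
  proof (rule tendsto_window[OF _ _ u(1)])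
    show "continuous_on UNIV ?f"
      by (intro continuous_on_prod continuous_unit_interp continuous_on_product_coordinates)
    have "0 \<le> ?f x" "?f x \<le> 1" for x
      by (intro prod_nonneg prod_le_1; simp add: unit_interp_bounds)+
    then show "bounded (range ?f)"
      by (intro boundedI[of _ 1]) (auto simp: abs_of_nonneg)
  qed
  have seq: "(\<integral>\<omega>. ?f (window (In n) u u \<omega>) \<partial>Cn n) =
    measure (Cn n) {\<omega> \<in> space (Mn n). \<forall>j\<in>J. (In n j \<omega> = 1) \<in> A j}" for n
  proof -
    interpret C: prob_space "Cn n" by (rule prob_Cn)
    have "(\<integral>\<omega>. ?f (window (In n) u u \<omega>) \<partial>Cn n) =
      (\<integral>\<omega>. indicator {\<omega> \<in> space (Mn n). \<forall>j\<in>J. (In n j \<omega> = 1) \<in> A j} \<omega> \<partial>Cn n)"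
    proof (rule Bochner_Integration.integral_cong)
      fix \<omega> assume "\<omega> \<in> space (Cn n)"
      then have \<omega>: "\<omega> \<in> space (Mn n)" by simp
      then have "?f (window (In n) u u \<omega>) = of_bool (\<forall>j\<in>J. (In n j \<omega> = 1) \<in> A j)"
        by (intro prod_unit_interp_window J u In_01)
      with \<omega> show "?f (window (In n) u u \<omega>) =
        indicator {\<omega> \<in> space (Mn n). \<forall>j\<in>J. (In n j \<omega> = 1) \<in> A j} \<omega>"
        by (simp add: indicator_def)
    qed simp
    also have "\<dots> = measure (Cn n) ({\<omega> \<in> space (Mn n). \<forall>j\<in>J. (In n j \<omega> = 1) \<in> A j} \<inter> space (Cn n))"
      by (rule Bochner_Integration.integral_indicator)
    also have "{\<omega> \<in> space (Mn n). \<forall>j\<in>J. (In n j \<omega> = 1) \<in> A j} \<inter> space (Cn n) =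
      {\<omega> \<in> space (Mn n). \<forall>j\<in>J. (In n j \<omega> = 1) \<in> A j}"
      unfolding space_uniform_measure by blast
    finally show ?thesis .
  qed
  have limit: "(\<integral>\<omega>. ?f (window I u u \<omega>) \<partial>M) = prob {\<omega> \<in> space M. \<forall>j\<in>J. (I j \<omega> = 1) \<in> A j}"
  proof -
    have ae: "AE \<omega> in M. \<forall>j\<in>J. I j \<omega> \<in> {0, 1}"
      using J AE_I_01 by (intro AE_finite_allI)
    have sets: "{\<omega> \<in> space M. \<forall>j\<in>J. (I j \<omega> = 1) \<in> A j} \<in> events"
      by (intro predE pred_all_finite J I_meas)
    have "(\<integral>\<omega>. ?f (window I u u \<omega>) \<partial>M) =
      (\<integral>\<omega>. indicator {\<omega> \<in> space M. \<forall>j\<in>J. (I j \<omega> = 1) \<in> A j} \<omega> \<partial>M)"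
    proof (rule integral_cong_AE)
      have [measurable]: "unit_interp B \<in> borel_measurable borel" for B
        by (rule borel_measurable_continuous_onI) (intro continuous_intros)
      have "?f \<in> borel_measurable borel"
        by (intro borel_measurable_continuous_onI continuous_on_prod continuous_unit_interp continuous_on_product_coordinates)
      then show "(\<lambda>\<omega>. ?f (window I u u \<omega>)) \<in> borel_measurable M"
        by (rule measurable_compose[rotated]) measurable
      show "indicator {\<omega> \<in> space M. \<forall>j\<in>J. (I j \<omega> = 1) \<in> A j} \<in> borel_measurable M"
        using sets by (rule borel_measurable_indicator)
      show "AE \<omega> in M. ?f (window I u u \<omega>) = indicator {\<omega> \<in> space M. \<forall>j\<in>J. (I j \<omega> = 1) \<in> A j} \<omega>"
        using ae AE_space
      proof eventually_elim
        fix \<omega> assume "\<forall>j\<in>J. I j \<omega> \<in> {0, 1}" "\<omega> \<in> space M"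
        moreover from this have "?f (window I u u \<omega>) = of_bool (\<forall>j\<in>J. (I j \<omega> = 1) \<in> A j)"
          by (intro prod_unit_interp_window J u) auto
        ultimately show "?f (window I u u \<omega>) = indicator {\<omega> \<in> space M. \<forall>j\<in>J. (I j \<omega> = 1) \<in> A j} \<omega>"
          by (simp add: indicator_def)
      qed
    qed
    also have "\<dots> = prob {\<omega> \<in> space M. \<forall>j\<in>J. (I j \<omega> = 1) \<in> A j}"
      unfolding Bochner_Integration.integral_indicator sets.Int_space_eq2[OF sets] ..
    finally show ?thesis .
  qed
  show ?thesis
    using lim unfolding seq limit .
qed

lemma stationary_cylinder:
  assumes "finite K"
  shows "measure (Mn n) {\<omega> \<in> space (Mn n). \<forall>j\<in>K. (In n (j - s) \<omega> = 1) \<in> A j} =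
    measure (Mn n) {\<omega> \<in> space (Mn n). \<forall>j\<in>K. (In n j \<omega> = 1) \<in> A j}"
proof -
  obtain u where u: "\<And>j. j \<in> K \<Longrightarrow> \<bar>j\<bar> \<le> int u"
    using finite_int_set_bounded[OF assms] by blast
  \<comment> \<open>Stationarity with shift - s. The window is cut after shifting, so one bound for
    K serves both sides.\<close>
  have "distr (Mn n) borel (window (\<lambda>t. In n (t + (- s))) u u) = distr (Mn n) borel (window (In n) u u)"
    using In_stat[of n] unfolding stationary_process_def by blast
  then have distr_eq: "distr (Mn n) borel (window (\<lambda>t. In n (t - s)) u u) = distr (Mn n) borel (window (In n) u u)"
    unfolding diff_conv_add_uminus .
  have "measure (Mn n) {\<omega> \<in> space (Mn n). \<forall>j\<in>K. (In n (j - s) \<omega> = 1) \<in> A j} =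
    measure (distr (Mn n) borel (window (\<lambda>t. In n (t - s)) u u)) {y. \<forall>j\<in>K. (y j = 1) \<in> A j}"
    by (rule measure_distr_window[OF assms u In_meas, symmetric])
  also have "\<dots> = measure (Mn n) {\<omega> \<in> space (Mn n). \<forall>j\<in>K. (In n j \<omega> = 1) \<in> A j}"
    unfolding distr_eq by (rule measure_distr_window[OF assms u In_meas])
  finally show ?thesis .
qed

text \<open>Along the sequence both events are contained in the conditioning event, so that their
  conditional probabilities have the same denominator and stationarity applies.\<close>

lemma prob_cylinder_shift:
  assumes K: "finite K" "0 \<in> K" "s \<in> K" and A: "A 0 \<subseteq> {True}" "A s \<subseteq> {True}"
  shows "prob {\<omega> \<in> space M. \<forall>j\<in>K. (I (j - s) \<omega> = 1) \<in> A j} =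
    prob {\<omega> \<in> space M. \<forall>j\<in>K. (I j \<omega> = 1) \<in> A j}"
proof -
  have cond: "measure (Cn n) E = measure (Mn n) E / measure (Mn n) (origin n)"
    if "E \<in> sets (Mn n)" "E \<subseteq> origin n" for n E
  proof -
    have "measure (Cn n) E = measure (Mn n) (origin n \<inter> E) / measure (Mn n) (origin n)"
      using emeasure_origin[of n] that(1) by (intro measure_uniform_measure) (simp_all add: less_top[symmetric])
    also have "origin n \<inter> E = E"
      using that(2) by blast
    finally show ?thesis .
  qed
  have eq: "measure (Cn n) {\<omega> \<in> space (Mn n). \<forall>j\<in>K. (In n (j - s) \<omega> = 1) \<in> A j} =
    measure (Cn n) {\<omega> \<in> space (Mn n). \<forall>j\<in>K. (In n j \<omega> = 1) \<in> A j}" for n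
  proof -
    have "measure (Cn n) {\<omega> \<in> space (Mn n). \<forall>j\<in>K. (In n (j - s) \<omega> = 1) \<in> A j} =
      measure (Mn n) {\<omega> \<in> space (Mn n). \<forall>j\<in>K. (In n (j - s) \<omega> = 1) \<in> A j} / measure (Mn n) (origin n)"
    proof (rule cond)
      show "{\<omega> \<in> space (Mn n). \<forall>j\<in>K. (In n (j - s) \<omega> = 1) \<in> A j} \<in> sets (Mn n)"
        by (intro predE pred_all_finite[where X="\<lambda>j. In n (j - s)"] K In_meas)
      have "In n 0 \<omega> = 1" if "\<forall>j\<in>K. (In n (j - s) \<omega> = 1) \<in> A j" for \<omega>
        using bspec[OF that K(3)] A(2) by auto
      then show "{\<omega> \<in> space (Mn n). \<forall>j\<in>K. (In n (j - s) \<omega> = 1) \<in> A j} \<subseteq> origin n"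
        by blast
    qed
    also have "\<dots> = measure (Mn n) {\<omega> \<in> space (Mn n). \<forall>j\<in>K. (In n j \<omega> = 1) \<in> A j} / measure (Mn n) (origin n)"
      by (simp only: stationary_cylinder[OF K(1)])
    also have "\<dots> = measure (Cn n) {\<omega> \<in> space (Mn n). \<forall>j\<in>K. (In n j \<omega> = 1) \<in> A j}"
    proof (rule cond[symmetric])
      show "{\<omega> \<in> space (Mn n). \<forall>j\<in>K. (In n j \<omega> = 1) \<in> A j} \<in> sets (Mn n)"
        by (intro predE pred_all_finite K In_meas)
      have "In n 0 \<omega> = 1" if "\<forall>j\<in>K. (In n j \<omega> = 1) \<in> A j" for \<omega>
        using bspec[OF that K(2)] A(1) by auto
      then show "{\<omega> \<in> space (Mn n). \<forall>j\<in>K. (In n j \<omega> = 1) \<in> A j} \<subseteq> origin n"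
        by blast
    qed
    finally show ?thesis .
  qed
  \<comment> \<open>Over the translated index set, with the constraints reindexed, the shifted event
    is itself a cylinder to which \<open>tendsto_cylinder\<close> applies.\<close>
  have image_In: "(\<forall>i\<in>(\<lambda>j. j - s) ` K. (In n i \<omega> = 1) \<in> A (i + s)) \<longleftrightarrow>
    (\<forall>j\<in>K. (In n (j - s) \<omega> = 1) \<in> A j)" for n \<omega>
    by simp
  have image_I: "(\<forall>i\<in>(\<lambda>j. j - s) ` K. (I i \<omega> = 1) \<in> A (i + s)) \<longleftrightarrow>
    (\<forall>j\<in>K. (I (j - s) \<omega> = 1) \<in> A j)" for \<omega>
    by simp
  have "finite ((\<lambda>j. j - s) ` K)"
    using K(1) by simp
  from tendsto_cylinder[OF this, of "\<lambda>i. A (i + s)"]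
  have "(\<lambda>n. measure (Cn n) {\<omega> \<in> space (Mn n). \<forall>j\<in>K. (In n (j - s) \<omega> = 1) \<in> A j}) \<longlonglongrightarrow>
    prob {\<omega> \<in> space M. \<forall>j\<in>K. (I (j - s) \<omega> = 1) \<in> A j}"
    unfolding image_In image_I .
  moreover have "(\<lambda>n. measure (Cn n) {\<omega> \<in> space (Mn n). \<forall>j\<in>K. (In n (j - s) \<omega> = 1) \<in> A j}) \<longlonglongrightarrow>
    prob {\<omega> \<in> space M. \<forall>j\<in>K. (I j \<omega> = 1) \<in> A j}"
    unfolding eq by (rule tendsto_cylinder[OF K(1)])
  ultimately show ?thesis
    by (rule LIMSEQ_unique)
qed

text \<open>Meaningful on the whole sample space, also where some \<open>I t\<close> is neither 0
  nor 1; off a null set it carries the same information as \<open>I\<close>.\<close>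

definition ones :: "'a \<Rightarrow> int \<Rightarrow> bool" where
  "ones \<omega> t \<longleftrightarrow> I t \<omega> = 1"

lemma measurable_ones [measurable]: "ones \<in> measurable M path_space"
  unfolding ones_def [abs_def] by (rule measurable_PiM_single') (auto simp: space_PiM)

text \<open>The map \<open>f\<close> covers both sides of the shift identity, with coordinates j and
  j - s.\<close>

lemma pred_ones:
  assumes "finite J"
  shows "Measurable.pred path_space (\<lambda>x. x s \<and> (\<forall>j\<in>J. x (f j) \<in> A j))"
proof (rule pred_intros_logic(3))
  show "Measurable.pred path_space (\<lambda>x. \<forall>j\<in>J. x (f j) \<in> A j)"
    by (rule pred_intros_finite(3)[OF assms], rule measurable_compose[OF measurable_coord]) simp
qed measurable

lemma emeasure_ones:
  assumes "finite J"
  shows "emeasure (distr M path_space ones) {x. x s \<and> (\<forall>j\<in>J. x (f j) \<in> A j)} =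
    emeasure M {\<omega> \<in> space M. ones \<omega> s \<and> (\<forall>j\<in>J. ones \<omega> (f j) \<in> A j)}"
proof -
  have "{x. x s \<and> (\<forall>j\<in>J. x (f j) \<in> A j)} \<in> sets path_space"
    using predE[OF pred_ones[OF assms, of s f A]] by (simp only: space_path_space UNIV_I simp_thms)
  then have "emeasure (distr M path_space ones) {x. x s \<and> (\<forall>j\<in>J. x (f j) \<in> A j)} =
    emeasure M (ones -` {x. x s \<and> (\<forall>j\<in>J. x (f j) \<in> A j)} \<inter> space M)"
    by (rule emeasure_distr[OF measurable_ones])
  also have "ones -` {x. x s \<and> (\<forall>j\<in>J. x (f j) \<in> A j)} \<inter> space M =
    {\<omega> \<in> space M. ones \<omega> s \<and> (\<forall>j\<in>J. ones \<omega> (f j) \<in> A j)}"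
    by blast
  finally show ?thesis .
qed

lemma palm_process_law: "palm_process (distr M path_space ones)"
proof -
  interpret N: prob_space "distr M path_space ones"
    by (rule prob_space_distr) measurable
  show ?thesis
  proof
    show "AE x in distr M path_space ones. x 0"
      by (subst AE_distr_iff) (use AE_I_origin in \<open>simp_all add: ones_def\<close>)
    fix J :: "int set" and A :: "int \<Rightarrow> bool set" and s :: int
    assume J: "finite J"
    \<comment> \<open>Prescribing True at 0 and s as well changes the event only by a null set, as
      the origin is almost surely a point, and gives it the form of
      \<open>prob_cylinder_shift\<close>. Under the shift the sites 0 and s become - s and
      0.\<close>
    define K where "K = insert 0 (insert s J)"
    define A' where "A' i = {b. (i = 0 \<longrightarrow> b) \<and> (i = s \<longrightarrow> b) \<and> (i \<in> J \<longrightarrow> b \<in> A i)}" for i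
    have K: "finite K" "0 \<in> K" "s \<in> K"
      using J by (simp_all add: K_def)
    have A': "A' 0 \<subseteq> {True}" "A' s \<subseteq> {True}"
      by (auto simp: A'_def)
    have sets: "{\<omega> \<in> space M. ones \<omega> s \<and> (\<forall>j\<in>J. ones \<omega> (f j) \<in> A j)} \<in> events" for s f
      by (rule predE) (rule measurable_compose[OF measurable_ones pred_ones[OF J]])
    have "emeasure (distr M path_space ones) {x. x s \<and> (\<forall>j\<in>J. x j \<in> A j)} =
      emeasure M {\<omega> \<in> space M. ones \<omega> s \<and> (\<forall>j\<in>J. ones \<omega> j \<in> A j)}"
      by (rule emeasure_ones[OF J])
    also have "\<dots> = emeasure M {\<omega> \<in> space M. \<forall>j\<in>K. (I j \<omega> = 1) \<in> A' j}"
    proof (rule emeasure_eq_AE)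
      show "AE \<omega> in M. \<omega> \<in> {\<omega> \<in> space M. ones \<omega> s \<and> (\<forall>j\<in>J. ones \<omega> j \<in> A j)} \<longleftrightarrow>
        \<omega> \<in> {\<omega> \<in> space M. \<forall>j\<in>K. (I j \<omega> = 1) \<in> A' j}"
        using AE_I_origin by eventually_elim (auto simp: K_def A'_def ones_def)
      show "{\<omega> \<in> space M. ones \<omega> s \<and> (\<forall>j\<in>J. ones \<omega> j \<in> A j)} \<in> events"
        by (rule sets)
      show "{\<omega> \<in> space M. \<forall>j\<in>K. (I j \<omega> = 1) \<in> A' j} \<in> events"
        by (intro predE pred_all_finite K I_meas)
    qed
    also have "\<dots> = emeasure M {\<omega> \<in> space M. \<forall>j\<in>K. (I (j - s) \<omega> = 1) \<in> A' j}"
      unfolding emeasure_eq_measure prob_cylinder_shift[OF K A'] ..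
    also have "\<dots> = emeasure M {\<omega> \<in> space M. ones \<omega> (- s) \<and> (\<forall>j\<in>J. ones \<omega> (j - s) \<in> A j)}"
    proof (rule emeasure_eq_AE)
      show "AE \<omega> in M. \<omega> \<in> {\<omega> \<in> space M. \<forall>j\<in>K. (I (j - s) \<omega> = 1) \<in> A' j} \<longleftrightarrow>
        \<omega> \<in> {\<omega> \<in> space M. ones \<omega> (- s) \<and> (\<forall>j\<in>J. ones \<omega> (j - s) \<in> A j)}"
        using AE_I_origin by eventually_elim (auto simp: K_def A'_def ones_def)
      show "{\<omega> \<in> space M. ones \<omega> (- s) \<and> (\<forall>j\<in>J. ones \<omega> (j - s) \<in> A j)} \<in> events"
        by (rule sets)
      show "{\<omega> \<in> space M. \<forall>j\<in>K. (I (j - s) \<omega> = 1) \<in> A' j} \<in> events"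
        by (intro predE pred_all_finite[where X="\<lambda>j. I (j - s)"] K I_meas)
    qed
    also have "\<dots> = emeasure (distr M path_space ones) {x. x (- s) \<and> (\<forall>j\<in>J. x (j - s) \<in> A j)}"
      by (rule emeasure_ones[OF J, symmetric])
    finally show "emeasure (distr M path_space ones) {x. x s \<and> (\<forall>j\<in>J. x j \<in> A j)} =
      emeasure (distr M path_space ones) {x. x (- s) \<and> (\<forall>j\<in>J. x (j - s) \<in> A j)}" .
  qed simp
qed

section \<open>Transfer of cluster sizes to the configuration law\<close>

lemma measurable_counts [measurable]:
  "S_i I \<in> borel_measurable M" "S_plus I \<in> borel_measurable M" "S_minus I \<in> borel_measurable M"
  unfolding S_i_def [abs_def] S_plus_def [abs_def] S_minus_def [abs_def]
  by (intro borel_measurable_infsum_ennreal measurable_compose[OF I_meas measurable_ennreal] countableI_type)+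

text \<open>Countably many sites give one common null set, off which \<open>I t\<close> is the
  indicator of a point at t and the sums become counts; for \<open>S_minus\<close> the sites are
  reflected.\<close>

lemma AE_counts:
  "AE \<omega> in M. S_i I \<omega> = ntotal (ones \<omega>) \<and> S_plus I \<omega> = nright (ones \<omega>) \<and> S_minus I \<omega> = nleft (ones \<omega>)"
proof -
  have "AE \<omega> in M. \<forall>t. I t \<omega> \<in> {0, 1}"
    by (subst AE_all_countable) (intro allI AE_I_01)
  then show ?thesis
  proof eventually_elim
    fix \<omega> assume "\<forall>t. I t \<omega> \<in> {0, 1}"
    then have I: "I t \<omega> = of_bool (ones \<omega> t)" for t
      by (auto simp: ones_def dest: spec[of _ t])
    have "{1::int..} = {0<..}"
      by auto
    moreover have "uminus ` {1::int..} = {..<0}"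
    proof -
      have "uminus ` {0::int<..} = {..<0}"
        by simp
      moreover have "{1::int..} = {0<..}"
        by auto
      ultimately show ?thesis by simp
    qed
    moreover have "npoints {1..} (\<lambda>t. ones \<omega> (- t)) = npoints (uminus ` {1..}) (ones \<omega>)"
      by (rule npoints_image) simp
    ultimately show "S_i I \<omega> = ntotal (ones \<omega>) \<and> S_plus I \<omega> = nright (ones \<omega>) \<and> S_minus I \<omega> = nleft (ones \<omega>)"
      unfolding S_i_def S_plus_def S_minus_def I infsum_ennreal_of_bool by simp
  qed
qed

abbreviation "law \<equiv> distr M path_space ones"

text \<open>Almost sure agreement is enough, so events about \<open>I\<close> can be read off its
  configuration despite the exceptional null set.\<close>

lemma measure_law:
  assumes "AE \<omega> in M. P \<omega> \<longleftrightarrow> Q (ones \<omega>)" "Measurable.pred M P" "Measurable.pred path_space Q"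
  shows "prob {\<omega> \<in> space M. P \<omega>} = measure law {x. Q x}"
proof -
  have Q: "{x. Q x} \<in> sets path_space"
    using predE[OF assms(3)] by (simp only: space_path_space UNIV_I simp_thms)
  have "measure law {x. Q x} = prob (ones -` {x. Q x} \<inter> space M)"
    by (rule measure_distr[OF measurable_ones Q])
  also have "\<dots> = prob {\<omega> \<in> space M. P \<omega>}"
  proof (rule finite_measure_eq_AE)
    show "AE \<omega> in M. \<omega> \<in> ones -` {x. Q x} \<inter> space M \<longleftrightarrow> \<omega> \<in> {\<omega> \<in> space M. P \<omega>}"
      using assms(1) by eventually_elim blast
    show "ones -` {x. Q x} \<inter> space M \<in> events"
      by (rule measurable_sets[OF measurable_ones Q])
    show "{\<omega> \<in> space M. P \<omega>} \<in> events"
      by (rule predE[OF assms(2)])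
  qed
  finally show ?thesis by simp
qed

lemma nn_integral_law:
  assumes "AE \<omega> in M. f \<omega> = g (ones \<omega>)" "g \<in> borel_measurable path_space"
  shows "(\<integral>\<^sup>+\<omega>. f \<omega> \<partial>M) = (\<integral>\<^sup>+x. g x \<partial>law)"
proof -
  have "(\<integral>\<^sup>+\<omega>. f \<omega> \<partial>M) = (\<integral>\<^sup>+\<omega>. g (ones \<omega>) \<partial>M)"
    by (rule nn_integral_cong_AE) (rule assms(1))
  also have "\<dots> = (\<integral>\<^sup>+x. g x \<partial>law)"
    by (rule nn_integral_distr[symmetric]) (simp_all add: assms(2))
  finally show ?thesis .
qed

text \<open>Writes an expectation under S^t as a restricted integral over a normalising probability,
  the form in which the transport identities deliver it.\<close>

lemma nn_integral_cond_law:
  assumes ae: "AE \<omega> in M. f \<omega> = g (ones \<omega>)"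
    and f [measurable]: "f \<in> borel_measurable M" and g [measurable]: "g \<in> borel_measurable path_space"
  shows "(\<integral>\<^sup>+\<omega>. f \<omega> \<partial>cond_measure M {\<omega> \<in> space M. S_minus I \<omega> = 0}) =
    (\<integral>\<^sup>+x. g x * of_bool (nleft x = 0) \<partial>law) / ennreal (measure law {x. nleft x = 0})"
proof -
  have "(\<integral>\<^sup>+\<omega>. f \<omega> \<partial>cond_measure M {\<omega> \<in> space M. S_minus I \<omega> = 0}) =
    (\<integral>\<^sup>+\<omega>. f \<omega> * indicator {\<omega> \<in> space M. S_minus I \<omega> = 0} \<omega> \<partial>M) / emeasure M {\<omega> \<in> space M. S_minus I \<omega> = 0}"
    by (rule nn_integral_uniform_measure) measurable
  also have "(\<integral>\<^sup>+\<omega>. f \<omega> * indicator {\<omega> \<in> space M. S_minus I \<omega> = 0} \<omega> \<partial>M) =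
    (\<integral>\<^sup>+x. g x * of_bool (nleft x = 0) \<partial>law)"
  proof (rule nn_integral_law)
    show "AE \<omega> in M. f \<omega> * indicator {\<omega> \<in> space M. S_minus I \<omega> = 0} \<omega> =
      g (ones \<omega>) * of_bool (nleft (ones \<omega>) = 0)"
      using ae AE_counts AE_space by eventually_elim (simp add: indicator_def)
  qed measurable
  also have "emeasure M {\<omega> \<in> space M. S_minus I \<omega> = 0} = ennreal (measure law {x. nleft x = 0})"
    unfolding emeasure_eq_measure
    by (rule arg_cong[where f=ennreal], rule measure_law)
      (use AE_counts in \<open>eventually_elim, simp\<close>, measurable)
  finally show ?thesis .
qed

end

section \<open>The extremal index and the moments of the cluster sizes\<close>

theorem theorem4p2:
  fixes M :: "'a measure" and I :: "int \<Rightarrow> 'a \<Rightarrow> real"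
    and Mn :: "nat \<Rightarrow> 'b measure" and In :: "nat \<Rightarrow> int \<Rightarrow> 'b \<Rightarrow> real"
  assumes M: "prob_space M"
    and I_meas: "\<And>t. I t \<in> borel_measurable M"
    and Mn: "\<And>n. prob_space (Mn n)"
    and In_meas: "\<And>n t. In n t \<in> borel_measurable (Mn n)"
    and In_01: "\<And>n t \<omega>. \<omega> \<in> space (Mn n) \<Longrightarrow> In n t \<omega> \<in> {0, 1}"
    and In_stat: "\<And>n. stationary_process (Mn n) (In n)"
    and In_pos: "\<And>n. measure (Mn n) {\<omega> \<in> space (Mn n). In n 0 \<omega> = 1} > 0"
    and conv: "\<And>u v. u \<ge> 1 \<Longrightarrow> v \<ge> 1 \<Longrightarrow>
       conv_in_distr
         (\<lambda>n. distr (cond_measure (Mn n) {\<omega> \<in> space (Mn n). In n 0 \<omega> = 1}) borel (window (In n) u v))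
         (distr M borel (window I u v))"
  defines "\<theta> \<equiv> measure M {\<omega> \<in> space M. S_plus I \<omega> = 0}"
    and "E_t \<equiv> (\<integral>\<^sup>+ \<omega>. S_i I \<omega> \<partial>cond_measure M {\<omega> \<in> space M. S_minus I \<omega> = 0})"
    and "E_t2 \<equiv> (\<integral>\<^sup>+ \<omega>. (S_i I \<omega>)\<^sup>2 \<partial>cond_measure M {\<omega> \<in> space M. S_minus I \<omega> = 0})"
    and "E_i \<equiv> (\<integral>\<^sup>+ \<omega>. S_i I \<omega> \<partial>M)"
    and "E_pm \<equiv> (\<integral>\<^sup>+ \<omega>. S_plus I \<omega> \<partial>M)"
    and "p_fin \<equiv> measure M {\<omega> \<in> space M. S_plus I \<omega> < \<infinity>}"
  shows
    "distr M borel (S_plus I) = distr M borel (S_minus I)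
     \<and> \<theta> = measure M {\<omega> \<in> space M. \<forall>t>0. I t \<omega> = 0}
     \<and> ((\<theta> = 0 \<longleftrightarrow> measure M {\<omega> \<in> space M. S_plus I \<omega> = \<infinity>} = 1)
        \<and> (\<theta> = 0 \<longleftrightarrow> measure M {\<omega> \<in> space M. S_i I \<omega> = \<infinity>} = 1))
     \<and> (\<theta> > 0 \<longleftrightarrow> measure M {\<omega> \<in> space M. S_i I \<omega> < \<infinity>} > 0)
     \<and> (\<theta> > 0 \<longrightarrow> ennreal \<theta> = ennreal p_fin / E_t)
     \<and> (\<theta> > 0 \<longrightarrow> p_fin = 1 \<longrightarrow>
          ennreal (1 / \<theta>) = E_t \<and> E_t \<le> E_i \<and> E_i = 1 + 2 * E_pm
          \<and> E_i = E_t2 / E_t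
          \<and> (E_t = E_i \<longrightarrow> (\<exists>k::nat. k \<ge> 1 \<and> measure M {\<omega> \<in> space M. S_i I \<omega> = of_nat k} = 1)))"
proof -
  interpret C: conditional_limit M I Mn In
    by (intro conditional_limit.intro conditional_limit_axioms.intro assms)
  interpret N: palm_process C.law
    by (rule C.palm_process_law)
  note [measurable] = I_meas
  have \<theta>: "\<theta> = N.prob {x. nright x = 0}"
    unfolding \<theta>_def by (rule C.measure_law) (use C.AE_counts in \<open>eventually_elim, simp\<close>, measurable)
  have p_fin: "p_fin = N.prob {x. nright x < \<infinity>}"
    unfolding p_fin_def by (rule C.measure_law) (use C.AE_counts in \<open>eventually_elim, simp\<close>, measurable)
  have plus_inf: "measure M {\<omega> \<in> space M. S_plus I \<omega> = \<infinity>} = N.prob {x. nright x = \<infinity>}"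
    by (rule C.measure_law) (use C.AE_counts in \<open>eventually_elim, simp\<close>, measurable)
  have i_inf: "measure M {\<omega> \<in> space M. S_i I \<omega> = \<infinity>} = N.prob {x. ntotal x = \<infinity>}"
    by (rule C.measure_law) (use C.AE_counts in \<open>eventually_elim, simp\<close>, measurable)
  have i_fin: "measure M {\<omega> \<in> space M. S_i I \<omega> < \<infinity>} = N.prob {x. ntotal x < \<infinity>}"
    by (rule C.measure_law) (use C.AE_counts in \<open>eventually_elim, simp\<close>, measurable)
  have i_eq: "measure M {\<omega> \<in> space M. S_i I \<omega> = of_nat k} = N.prob {x. ntotal x = of_nat k}" for k
    by (rule C.measure_law) (use C.AE_counts in \<open>eventually_elim, simp\<close>, measurable)
  \<comment> \<open>\<theta> is defined through the right half, the conditioning event of S^t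
    through the left half; the equality of the two laws makes \<theta> the normalising
    constant.\<close>
  have left_0: "N.prob {x. nleft x = 0} = \<theta>"
    using N.prob_right_left[of "{0}"] by (simp add: \<theta>)
  have E_t: "E_t = ennreal p_fin / ennreal \<theta>"
  proof -
    have "E_t = (\<integral>\<^sup>+x. ntotal x * of_bool (nleft x = 0) \<partial>C.law) / ennreal (N.prob {x. nleft x = 0})"
      unfolding E_t_def
      by (rule C.nn_integral_cond_law) (use C.AE_counts in \<open>eventually_elim, simp\<close>, measurable)
    then show ?thesis
      by (simp only: N.nn_integral_total_left_0 left_0 p_fin)
  qed
  have E_i: "E_i = (\<integral>\<^sup>+x. ntotal x \<partial>C.law)"
    unfolding E_i_def by (rule C.nn_integral_law) (use C.AE_counts in \<open>eventually_elim, simp\<close>, measurable)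
  have E_pm: "E_pm = (\<integral>\<^sup>+x. nright x \<partial>C.law)"
    unfolding E_pm_def by (rule C.nn_integral_law) (use C.AE_counts in \<open>eventually_elim, simp\<close>, measurable)
  have E_t2: "E_t2 = E_i / ennreal \<theta>" if "p_fin = 1"
  proof -
    have "E_t2 = (\<integral>\<^sup>+x. (ntotal x)\<^sup>2 * of_bool (nleft x = 0) \<partial>C.law) / ennreal (N.prob {x. nleft x = 0})"
      unfolding E_t2_def
      by (rule C.nn_integral_cond_law) (use C.AE_counts in \<open>eventually_elim, simp\<close>, measurable)
    then show ?thesis
      by (simp only: N.nn_integral_total_squared_left_0[OF that[unfolded p_fin]] left_0 E_i)
  qed
  have pos_iff: "\<theta> > 0 \<longleftrightarrow> p_fin > 0"
    unfolding \<theta> p_fin by (rule N.prob_right_0_pos_iff)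
  have zero_iff: "\<theta> = 0 \<longleftrightarrow> p_fin = 0"
    using pos_iff by (simp add: \<theta>_def p_fin_def zero_less_measure_iff)
  have plus_ae: "AE \<omega> in M. S_plus I \<omega> = (nright \<circ> C.ones) \<omega>"
    using C.AE_counts by eventually_elim simp
  have minus_ae: "AE \<omega> in M. (nleft \<circ> C.ones) \<omega> = S_minus I \<omega>"
    using C.AE_counts by eventually_elim simp
  have "distr M borel (S_plus I) = distr M borel (nright \<circ> C.ones)"
    by (intro distr_cong_AE refl plus_ae) measurable
  also have "\<dots> = distr C.law borel nright"
    by (rule distr_distr[symmetric]) measurable
  also have "\<dots> = distr C.law borel nleft"
    by (rule N.distr_npoints)
  also have "\<dots> = distr M borel (nleft \<circ> C.ones)"
    by (rule distr_distr) measurable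
  also have "\<dots> = distr M borel (S_minus I)"
    by (intro distr_cong_AE refl minus_ae) measurable
  finally have same_law: "distr M borel (S_plus I) = distr M borel (S_minus I)" .
  have \<theta>_alt: "\<theta> = measure M {\<omega> \<in> space M. \<forall>t>0. I t \<omega> = 0}"
  proof -
    have "AE \<omega> in M. \<forall>t. I t \<omega> \<in> {0, 1}"
      by (subst AE_all_countable) (intro allI C.AE_I_01)
    then have "AE \<omega> in M. (\<forall>t>0. I t \<omega> = 0) \<longleftrightarrow> nright (C.ones \<omega>) = 0"
      by eventually_elim (auto simp: npoints_eq_0_iff C.ones_def)
    then show ?thesis
      unfolding \<theta> by (intro C.measure_law[symmetric]) measurable
  qed
  have a: "\<theta> = 0 \<longleftrightarrow> measure M {\<omega> \<in> space M. S_plus I \<omega> = \<infinity>} = 1"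
    unfolding plus_inf N.prob_eq_infinity p_fin[symmetric] by (rule zero_iff)
  have b: "\<theta> = 0 \<longleftrightarrow> measure M {\<omega> \<in> space M. S_i I \<omega> = \<infinity>} = 1"
    unfolding i_inf N.prob_eq_infinity N.prob_total_finite p_fin[symmetric] by (rule zero_iff)
  have c: "\<theta> > 0 \<longleftrightarrow> measure M {\<omega> \<in> space M. S_i I \<omega> < \<infinity>} > 0"
    unfolding i_fin N.prob_total_finite p_fin[symmetric] by (rule pos_iff)
  \<comment> \<open>Cancelling \<open>p_fin\<close> in the quotient of \<open>p_fin\<close> by
    \<open>p_fin / \<theta>\<close> requires it to be positive, which \<open>pos_iff\<close>
    supplies.\<close>
  have d: "ennreal \<theta> = ennreal p_fin / E_t" if "\<theta> > 0"
    using that pos_iff by (simp add: E_t divide_ennreal)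
  have e: "ennreal (1 / \<theta>) = E_t \<and> E_t \<le> E_i \<and> E_i = 1 + 2 * E_pm
      \<and> E_i = E_t2 / E_t
      \<and> (E_t = E_i \<longrightarrow> (\<exists>k::nat. k \<ge> 1 \<and> measure M {\<omega> \<in> space M. S_i I \<omega> = of_nat k} = 1))"
    if "\<theta> > 0" "p_fin = 1"
  proof (intro conjI impI)
    show E_t': "ennreal (1 / \<theta>) = E_t"
      unfolding E_t using that divide_ennreal[of 1 \<theta>] by simp
    note harmonic = N.harmonic_mean_total[OF that(2)[unfolded p_fin] that(1)[unfolded \<theta>]]
    show "E_t \<le> E_i"
      using harmonic(1) unfolding E_t'[symmetric] E_i \<theta> .
    show "E_i = 1 + 2 * E_pm"
      unfolding E_i E_pm by (rule N.nn_integral_total)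
    show "E_i = E_t2 / E_t"
    proof -
      \<comment> \<open>\<open>E_i\<close> may be \<infinity>, so the factors are regrouped until
        only the positive real \<theta> has to be cancelled.\<close>
      have "inverse (ennreal (1 / \<theta>)) = ennreal \<theta>"
        using that(1) by (simp add: inverse_ennreal)
      then have "E_t2 / E_t = E_i / ennreal \<theta> * ennreal \<theta>"
        by (simp only: E_t2[OF that(2)] E_t'[symmetric] divide_ennreal_def)
      also have "\<dots> = E_i * (ennreal \<theta> / ennreal \<theta>)"
        by (simp add: divide_ennreal_def mult_ac)
      also have "\<dots> = E_i"
        using that(1) by simp
      finally show ?thesis by simp
    qed
    assume "E_t = E_i"
    then show "\<exists>k::nat. k \<ge> 1 \<and> measure M {\<omega> \<in> space M. S_i I \<omega> = of_nat k} = 1"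
      unfolding i_eq using harmonic(2) unfolding E_t'[symmetric] E_i \<theta> by blast
  qed
  show ?thesis
    using same_law \<theta>_alt a b c d e by blast
qed

end
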